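(* There exists a homogeneous subspace $X$ of $2^\omega$ whose complement $2^\omega\setminus X$ is dense in $2^\omega$ and rigid.
   Context: $2^\omega$ is the Cantor set with the product topology. For a space $Z$, $\mathcal{H}(Z)$ denotes the group of homeomorphisms of $Z$ onto itself. A space $Z$ is homogeneous if for every pair $(x,y)$ of points of $Z$ there exists $h\in\mathcal{H}(Z)$ such that $h(x)=y$. A space $Z$ is rigid if $\mathcal{H}(Z)=\{\mathrm{id}\}$. Subsets of $2^\omega$ carry the subspace topology. The result is in $\mathsf{ZFC}$. *)

theory Defs
  imports "HOL-Analysis.Analysis"
begin

abbreviation Cantor_space :: "(nat \<Rightarrow> bool) topology"
  where "Cantor_space \<equiv> product_topology (\<lambda>_. discrete_topology UNIV) UNIV"

(* Self-homeomorphisms are taken to be extensional (equal to undefined off topspace Z),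
   so that two of them are equal as HOL functions iff they agree on the points of Z. *)
definition homeos :: "'a topology \<Rightarrow> ('a \<Rightarrow> 'a) set"
  where "homeos Z = {h \<in> extensional (topspace Z). homeomorphic_map Z Z h}"

definition homogeneous_space :: "'a topology \<Rightarrow> bool"
  where "homogeneous_space Z \<longleftrightarrow>
    (\<forall>x\<in>topspace Z. \<forall>y\<in>topspace Z. \<exists>h\<in>homeos Z. h x = y)"

definition rigid_space :: "'a topology \<Rightarrow> bool"
  where "rigid_space Z \<longleftrightarrow> homeos Z = {\<lambda>x\<in>topspace Z. x}"

end

theory Submission
  imports Defs "HOL-Library.Function_Algebras" "HOL-Library.Equipollence" "HOL-Library.Z2"
begin

text \<open>
  Translations make a subgroup of a topological group homogeneous. The idea is to take a subgroup of the Cantor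
  group and to place it in another copy of the Cantor set, in such a way that no nonzero translation extends to
  the rest of that copy.

  Let \<open>C\<close> be the Boolean group of bit sequences and \<open>D\<close> the countable dense subgroup of
  the sequences that are eventually \<open>0\<close>. There is a continuous surjection \<open>collapse\<close>
  from the Cantor space onto \<open>C\<close> that is injective over \<open>C - D\<close>, whereas each point of
  \<open>D\<close> has two preimages (\<open>collapse_inj\<close>, \<open>collapse_two_preimages\<close>). Take a
  subgroup \<open>H\<close> of \<open>C\<close> meeting \<open>D\<close> only in \<open>0\<close>, and let
  \<open>X\<close> be the preimage of the coset \<open>1 + H\<close>, where \<open>1\<close> is the constant
  sequence; \<open>H\<close> is chosen such that this coset misses \<open>D\<close>. Then \<open>X\<close> is
  homeomorphic to the coset, hence homogeneous, and its complement \<open>Y\<close> is dense since it contains the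
  preimage of \<open>D\<close>.

  A homeomorphism \<open>f\<close> of \<open>Y\<close> is determined by its restriction to a countable dense
  subset of \<open>Y\<close>, so there are only continuum many; the restriction also determines a continuous
  extension \<open>F\<close> of \<open>f\<close> to a \<open>G\<^sub>\<delta>\<close> set containing
  \<open>Y\<close>. A point \<open>a\<close> with \<open>collapse a \<notin> 1 + H\<close> and \<open>collapse (F
  a) \<in> 1 + H\<close> refutes that \<open>f\<close> maps \<open>Y\<close> to itself, because then \<open>a
  \<in> Y\<close> and \<open>f a = F a \<in> X\<close>. The group \<open>H\<close> is built by transfinite
  recursion over all \<open>f\<close>, adding \<open>collapse (F a) + 1\<close> for a suitable \<open>a\<close> at
  each step (\<open>generic_subgroup\<close>). For this step it suffices that \<open>collapse a\<close>,
  \<open>collapse (F a)\<close> and their sum avoid a given set of fewer than continuum many elements of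
  \<open>C\<close>. When none of the three functions is locally constant in the vicinity of some point, a Cantor
  scheme yields continuum many points \<open>a\<close> at which all three take pairwise different values, and such
  an \<open>a\<close> exists (\<open>avoid_small_set\<close>).

  It remains to see that every \<open>f\<close> other than the identity is of this kind
  (\<open>rich_tests\<close>). The first two functions are not locally constant since \<open>collapse\<close> has
  nowhere dense fibres and \<open>f\<close> is open. If the third one has the constant value \<open>x\<close> near
  some point that \<open>f\<close> moves, then \<open>f\<close> is locally the translation by \<open>x\<close>. If
  \<open>x \<notin> H\<close>, this translation moves a point outside the dense coset into the coset. If
  \<open>x\<close> is a nonzero element of \<open>H\<close>, then for \<open>d \<in> D\<close> the two preimages
  of \<open>d\<close> are sent to the single preimage of \<open>d + x \<notin> D\<close>, against injectivity. If
  \<open>x = 0\<close>, then \<open>f\<close> maps the fibre over some \<open>d \<in> D\<close> into itself,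
  although that fibre lies in an open set that \<open>f\<close> maps off itself.
\<close>

unbundle cardinal_syntax

section \<open>Sets of small cardinality\<close>

lemma uncountable_Cantor: "uncountable (UNIV :: (nat \<Rightarrow> bool) set)"
proof
  assume "countable (UNIV :: (nat \<Rightarrow> bool) set)"
  then obtain e :: "nat \<Rightarrow> nat \<Rightarrow> bool" where e: "range e = UNIV" using uncountable_def by blast
  then obtain k where "e k = (\<lambda>n. \<not> e n n)" by (metis UNIV_I rangeE)
  then show False by (metis (full_types))
qed

lemma lepoll_iff_ordLeq: "A \<lesssim> B \<longleftrightarrow> |A| \<le>o |B|"
  unfolding lepoll_def by (rule card_of_ordLeq)

lemma lesspoll_iff_ordLess: "A \<prec> B \<longleftrightarrow> |A| <o |B|"
  unfolding lesspoll_def lepoll_iff_ordLeq eqpoll_iff_card_of_ordIso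
  using not_ordLess_ordIso ordLeq_iff_ordLess_or_ordIso by blast

lemma Un_lesspoll:
  assumes "infinite C" "A \<prec> C" "B \<prec> C"
  shows "A \<union> B \<prec> C"
  using assms by (simp add: lesspoll_iff_ordLess card_of_Un_ordLess_infinite)

lemma Un_lepoll:
  assumes "infinite C" "A \<lesssim> C" "B \<lesssim> C"
  shows "A \<union> B \<lesssim> C"
  using assms unfolding lepoll_iff_ordLeq
  by (intro card_of_Un_ordLeq_infinite_Field) (auto simp: Field_card_of card_of_card_order_on)

lemma image_lesspoll: "A \<prec> C \<Longrightarrow> f ` A \<prec> C"
  using image_lepoll lesspoll_trans1 by blast

lemma countable_lesspoll_uncountable:
  assumes "countable A" "uncountable B"
  shows "A \<prec> B"
proof -
  have "A \<lesssim> (UNIV::nat set)"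
    using assms(1) by (auto simp: countable_def lepoll_def)
  also have "(UNIV::nat set) \<prec> B"
    using assms(2) uncountable_infinite[OF assms(2)] countable_eqpoll[of "UNIV::nat set" B] eqpoll_sym
    by (auto simp: lesspoll_def infinite_le_lepoll)
  finally show ?thesis .
qed

text \<open>
  Induction on the cardinality: a set of \<open>n + 1\<close> elements is an element added to a set of
  \<open>n\<close> elements, and an infinite \<open>B\<close> absorbs its square and countable unions of sets no
  larger than \<open>B\<close>.
\<close>

lemma Fpow_lepoll:
  assumes "infinite B"
  shows "Fpow B \<lesssim> B"
proof -
  define L where "L n = {F. F \<subseteq> B \<and> finite F \<and> card F = n}" for n
  have L: "|L n| \<le>o |B|" for n
  proof (induction n)
    case 0
    have "L 0 \<subseteq> {{}}" by (auto simp: L_def)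
    then have "finite (L 0)" by (rule finite_subset) simp
    then show ?case using assms
      by (simp add: finite_lepoll_infinite flip: lepoll_iff_ordLeq)
  next
    case (Suc n)
    have "L (Suc n) \<subseteq> (\<lambda>(b, F). insert b F) ` (B \<times> L n)"
    proof
      fix F assume F: "F \<in> L (Suc n)"
      then obtain b where b: "b \<in> F" unfolding L_def by force
      with F have "F - {b} \<in> L n" "b \<in> B" by (auto simp: L_def)
      then have "(b, F - {b}) \<in> B \<times> L n" by simp
      then show "F \<in> (\<lambda>(b, F). insert b F) ` (B \<times> L n)"
        by (rule rev_image_eqI) (use b in auto)
    qed
    then have "L (Suc n) \<lesssim> B \<times> L n" by (rule subset_image_lepoll)
    then have 1: "|L (Suc n)| \<le>o |B \<times> L n|" by (simp add: lepoll_iff_ordLeq)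
    have "|B \<times> L n| \<le>o |B|"
      using card_of_Times_ordLeq_infinite_Field[of "|B|" B "L n"] assms Suc
      by (simp add: card_of_card_order_on card_of_mono1 Field_card_of)
    with 1 show ?case using ordLeq_transitive by blast
  qed
  have "|\<Union>n. L n| \<le>o |B|"
    using assms L infinite_iff_card_of_nat by (intro card_of_UNION_ordLeq_infinite) auto
  moreover have "Fpow B = (\<Union>n. L n)" by (auto simp: L_def Fpow_def)
  ultimately show ?thesis by (simp add: lepoll_iff_ordLeq)
qed

section \<open>A generic subgroup of a Boolean group\<close>

text \<open>
  When \<open>x + x = 0\<close> holds throughout, this is the subgroup generated by the family; indexing by
  \<open>I\<close> lets a well-order of \<open>I\<close> single out the last summand of each element.
\<close>

definition finite_sums :: "('i \<Rightarrow> 'a::comm_monoid_add) \<Rightarrow> 'i set \<Rightarrow> 'a set"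
  where "finite_sums f I = sum f ` Fpow I"

lemma finite_sums_lesspoll:
  assumes "uncountable C" "I \<prec> C"
  shows "finite_sums f I \<prec> C"
proof (cases "finite I")
  case True
  then have "countable (finite_sums f I)"
    unfolding finite_sums_def by (intro countable_image countable_Fpow countable_finite)
  then show ?thesis using assms(1) countable_lesspoll_uncountable by blast
next
  case False
  then have "Fpow I \<prec> C" using Fpow_lepoll assms(2) lesspoll_trans1 by blast
  then show ?thesis unfolding finite_sums_def by (rule image_lesspoll)
qed

lemma finite_sums_zero: "0 \<in> finite_sums f I"
  unfolding finite_sums_def Fpow_def by (rule image_eqI[of _ _ "{}"]) auto

lemma finite_sums_mono: "I \<subseteq> J \<Longrightarrow> finite_sums f I \<subseteq> finite_sums f J"
  unfolding finite_sums_def Fpow_def by blast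

lemma sum_in_finite_sums: "finite F \<Longrightarrow> F \<subseteq> I \<Longrightarrow> sum f F \<in> finite_sums f I"
  unfolding finite_sums_def Fpow_def by blast

text \<open>The summands common to both sums cancel, which leaves the sum over the symmetric difference.\<close>

lemma finite_sums_add:
  fixes f :: "'i \<Rightarrow> 'a::comm_monoid_add"
  assumes two: "\<And>x::'a. x + x = 0" and x: "x \<in> finite_sums f I" and y: "y \<in> finite_sums f I"
  shows "x + y \<in> finite_sums f I"
proof -
  obtain F G where F: "finite F" "F \<subseteq> I" "x = sum f F" and G: "finite G" "G \<subseteq> I" "y = sum f G"
    using x y by (auto simp: finite_sums_def Fpow_def)
  have "sum f F = sum f (F - G) + sum f (F \<inter> G)" "sum f G = sum f (G - F) + sum f (F \<inter> G)"
    using F G by (metis add.commute sum.Int_Diff Int_commute)+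
  then have "x + y = sum f (F - G) + sum f (G - F) + (sum f (F \<inter> G) + sum f (F \<inter> G))"
    using F G by (simp add: ac_simps)
  also have "\<dots> = sum f ((F - G) \<union> (G - F))"
    using F G by (subst sum.union_disjoint) (auto simp: two)
  finally show ?thesis using F G by (auto intro!: sum_in_finite_sums)
qed

text \<open>
  The condition that lets the recursion step of \<open>generic_subgroup\<close> go through: if \<open>V\<close> is
  a subgroup of a Boolean group, then \<open>a\<close> and \<open>b\<close> are independent modulo
  \<open>V\<close>.
\<close>

definition rich :: "'k set \<Rightarrow> ('a \<times> 'a::plus) set \<Rightarrow> bool"
  where "rich \<kappa> T \<longleftrightarrow> (\<forall>V. V \<prec> \<kappa> \<longrightarrow> (\<exists>(a, b) \<in> T. a \<notin> V \<and> b \<notin> V \<and> a + b \<notin> V))"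

text \<open>
  Well-order \<open>\<T>\<close> with initial segments smaller than \<open>\<kappa>\<close>, and choose by
  recursion a pair in each \<open>T\<close> that is independent of the span \<open>W T\<close> of \<open>G\<close>
  and of all entries of earlier pairs. The group \<open>H\<close> is generated by the second entries, shifted by
  \<open>v\<close>. A nontrivial element of \<open>H\<close> has a last generator \<open>b m\<close> and agrees
  with \<open>b m\<close> modulo \<open>W m\<close>. So it is not in \<open>G\<close>, and it is not in \<open>a T
  + G\<close> either: depending on whether \<open>T\<close> comes before, at or after \<open>m\<close>, this would
  put \<open>b m\<close>, \<open>a T + b T\<close> or \<open>a T\<close> into the span that it was chosen to
  avoid.
\<close>

lemma generic_subgroup:
  fixes G :: "'a::ab_group_add set" and \<T> :: "('a \<times> 'a) set set" and \<kappa> :: "'k set"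
  assumes two: "\<And>x::'a. x + x = 0"
    and \<kappa>: "uncountable \<kappa>" and G: "countable G" "0 \<in> G" and v: "v \<in> G"
    and \<T>: "\<T> \<lesssim> \<kappa>" and rich: "\<And>T. T \<in> \<T> \<Longrightarrow> rich \<kappa> T"
  obtains H where "0 \<in> H" "\<And>x y. x \<in> H \<Longrightarrow> y \<in> H \<Longrightarrow> x + y \<in> H" "H \<inter> G = {0}"
    "\<And>T. T \<in> \<T> \<Longrightarrow> \<exists>(a, b) \<in> T. b + v \<in> H \<and> (\<forall>g\<in>G. a + g \<notin> H)"
proof -
  define r where "r = |\<T>| - Id"
  have wo: "well_order_on \<T> |\<T>|" by (rule card_of_well_order_on)
  then have wf: "wf r" and tot: "total_on \<T> r" and tr: "trans r"
    unfolding r_def well_order_on_def linear_order_on_def partial_order_on_def preorder_on_def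
    by (auto simp: total_on_def intro: trans_diff_Id)
  have field: "S \<in> \<T> \<and> T \<in> \<T>" if "(S, T) \<in> r" for S T
    using that Field_card_of[of \<T>] unfolding r_def by (auto simp: Field_def)
  have small: "{S. (S, T) \<in> r} \<prec> \<kappa>" if "T \<in> \<T>" for T
  proof -
    have "{S. (S, T) \<in> r} = underS |\<T>| T" by (auto simp: r_def underS_def)
    moreover have "|underS |\<T>| T| <o |\<T>|"
      using that by (intro card_of_underS card_of_Card_order) (simp add: Field_card_of)
    ultimately have "{S. (S, T) \<in> r} \<prec> \<T>" by (simp add: lesspoll_iff_ordLess)
    then show ?thesis using \<T> lesspoll_trans2 by blast
  qed
  define V where "V c T = finite_sums (\<lambda>x. x) (G \<union> (fst \<circ> c) ` {S. (S, T) \<in> r} \<union> (snd \<circ> c) ` {S. (S, T) \<in> r})"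
    for c and T :: "('a \<times> 'a) set"
  have V_small: "V c T \<prec> \<kappa>" if "T \<in> \<T>" for c T
    unfolding V_def using small[OF that] \<kappa> G countable_lesspoll_uncountable
    by (intro finite_sums_lesspoll Un_lesspoll image_lesspoll) (auto simp: uncountable_infinite)
  define ok where "ok c T p \<longleftrightarrow> T \<in> \<T> \<longrightarrow>
      p \<in> T \<and> fst p \<notin> V c T \<and> snd p \<notin> V c T \<and> fst p + snd p \<notin> V c T" for c T and p :: "'a \<times> 'a"
  have "\<exists>c. \<forall>T. ok c T (c T)"
  proof (rule dependent_wf_choice[OF wf])
    fix c c' :: "('a \<times> 'a) set \<Rightarrow> 'a \<times> 'a" and T and p :: "'a \<times> 'a"
    assume "\<And>S. (S, T) \<in> r \<Longrightarrow> c S = c' S"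
    then have "V c T = V c' T" unfolding V_def by (intro arg_cong2[where f=finite_sums]) auto
    then show "ok c T p = ok c' T p" by (simp add: ok_def)
  next
    fix T c
    show "\<exists>p. ok c T p"
    proof (cases "T \<in> \<T>")
      case True
      from rich[OF this, unfolded rich_def, rule_format, OF V_small[OF True, of c]]
      show ?thesis by (auto simp: ok_def)
    qed (simp add: ok_def)
  qed
  then obtain c where c: "\<And>T. ok c T (c T)" by blast
  define a b where "a T = fst (c T)" and "b T = snd (c T) + v" for T
  define W where "W T = V c T" for T
  have W_add: "x + y \<in> W T" if "x \<in> W T" "y \<in> W T" for x y T
    using that unfolding W_def V_def by (intro finite_sums_add two)
  have gen: "x \<in> W T" if "x \<in> G \<union> (fst \<circ> c) ` {S. (S, T) \<in> r} \<union> (snd \<circ> c) ` {S. (S, T) \<in> r}" for x T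
    unfolding W_def V_def using sum_in_finite_sums[of "{x}" _ "\<lambda>x. x"] that by simp
  have G_W: "g \<in> W T" if "g \<in> G" for g T using that gen by simp
  have a_W: "a S \<in> W T" and b_W: "b S \<in> W T" if "(S, T) \<in> r" for S T
  proof -
    have "fst (c S) \<in> W T" "snd (c S) \<in> W T" using that by (auto intro!: gen)
    then show "a S \<in> W T" "b S \<in> W T" unfolding a_def b_def by (auto intro: W_add G_W v)
  qed
  have cancel: "y \<in> W T" if "x + y \<in> W T" "x \<in> W T" for x y T
  proof -
    have "x + (x + y) \<in> W T" by (rule W_add[OF that(2,1)])
    moreover have "x + (x + y) = y" by (metis two add.assoc add_0)
    ultimately show ?thesis by simp
  qed
  have fresh: "a T \<notin> W T" "b T \<notin> W T" "a T + b T \<notin> W T" if "T \<in> \<T>" for T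
  proof -
    have "c T \<in> T \<and> fst (c T) \<notin> W T \<and> snd (c T) \<notin> W T \<and> fst (c T) + snd (c T) \<notin> W T"
      using c[of T] that by (auto simp: ok_def W_def)
    moreover have "b T = v + snd (c T)" "a T + b T = v + (fst (c T) + snd (c T))"
      by (simp_all add: a_def b_def ac_simps)
    ultimately show "a T \<notin> W T" "b T \<notin> W T" "a T + b T \<notin> W T"
      using cancel[OF _ G_W[OF v]] by (metis a_def)+
  qed
  \<comment> \<open>A sum of generators is congruent to its last generator modulo everything chosen before it.\<close>
  have last: "\<exists>m\<in>F. \<exists>s\<in>W m. sum b F = s + b m \<and> F \<subseteq> insert m {S. (S, m) \<in> r}"
    if F: "finite F" "F \<subseteq> \<T>" "F \<noteq> {}" for F
  proof -
    have "\<exists>m\<in>F. \<forall>S\<in>F. (m, S) \<notin> r"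
    proof -
      have wf': "wf ((r \<inter> F \<times> F)\<inverse>)"
        using F(1) wf_subset[OF wf, of "r \<inter> F \<times> F"]
        by (intro finite_acyclic_wf_converse wf_acyclic) auto
      obtain z where "z \<in> F" using F(3) by blast
      from wf'[unfolded wf_eq_minimal, rule_format, OF this] show ?thesis
        by simp metis
    qed
    then obtain m where m: "m \<in> F" "\<forall>S\<in>F. (m, S) \<notin> r" by blast
    have below: "(S, m) \<in> r" if "S \<in> F" "S \<noteq> m" for S
      using that m F tot unfolding total_on_def by blast
    have "sum b F' \<in> W m" if "F' \<subseteq> F - {m}" for F'
      using finite_subset[OF that] F(1) that
    proof (induction F' rule: infinite_finite_induct)
      case empty
      then show ?case using G_W G by simp
    next
      case (insert S F')
      then show ?case using below by (auto intro!: W_add b_W)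
    qed simp
    then have "sum b (F - {m}) \<in> W m" by blast
    moreover have "sum b F = sum b (F - {m}) + b m"
      using sum.remove[OF F(1) m(1), of b] by (simp only: add.commute)
    ultimately show ?thesis using m below by blast
  qed
  define H where "H = finite_sums b \<T>"
  show ?thesis
  proof (rule that)
    show "0 \<in> H" unfolding H_def by (rule finite_sums_zero)
    show "x + y \<in> H" if "x \<in> H" "y \<in> H" for x y
      using that unfolding H_def by (intro finite_sums_add two)
    show "H \<inter> G = {0}"
    proof -
      have "x = 0" if x: "x \<in> H" "x \<in> G" for x
      proof (rule ccontr)
        assume "x \<noteq> 0"
        from x(1) obtain F where F: "finite F" "F \<subseteq> \<T>" "x = sum b F"
          by (auto simp: H_def finite_sums_def Fpow_def)
        with \<open>x \<noteq> 0\<close> have "F \<noteq> {}" by auto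
        from last[OF F(1,2) this] obtain m s where m: "m \<in> F" "s \<in> W m" "x = s + b m"
          unfolding F(3) by blast
        then have "b m \<in> W m" using cancel[of s "b m" m] G_W[OF x(2), of m] by simp
        then show False using fresh m F by blast
      qed
      then show ?thesis using G \<open>0 \<in> H\<close> by blast
    qed
    show "\<exists>(a, b) \<in> T. b + v \<in> H \<and> (\<forall>g\<in>G. a + g \<notin> H)" if T: "T \<in> \<T>" for T
    proof -
      have "sum b {T} \<in> H" unfolding H_def using T by (intro sum_in_finite_sums) auto
      then have "snd (c T) + v \<in> H" by (simp add: b_def)
      moreover have "fst (c T) + g \<notin> H" if g: "g \<in> G" for g
      proof
        assume "fst (c T) + g \<in> H"
        then obtain F where F: "finite F" "F \<subseteq> \<T>" "a T + g = sum b F"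
          by (auto simp: H_def finite_sums_def Fpow_def a_def)
        have "F \<noteq> {}"
        proof
          assume "F = {}"
          then have "g + a T = 0" using F(3) by (simp add: add.commute)
          then have "g + a T \<in> W T" using G_W[OF G(2), of T] by simp
          then show False using cancel G_W[OF g] fresh T by blast
        qed
        from last[OF F(1,2) this] obtain m s where
          m: "m \<in> F" "s \<in> W m" "a T + g = s + b m" unfolding F(3) by blast
        have mT: "m \<in> \<T>" using m F by blast
        have eq: "a T = (g + s) + b m"
        proof -
          have "a T = (a T + g) + g" by (simp add: two add.assoc)
          then show ?thesis unfolding m(3) by (simp only: ac_simps)
        qed
        have gs: "g + s \<in> W m" using G_W[OF g] m by (intro W_add)
        consider "m = T" | "(m, T) \<in> r" | "(T, m) \<in> r"
          using tot T mT unfolding total_on_def by blast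
        then show False
        proof cases
          case 1
          have "a T + b T = g + s"
            by (simp only: eq[unfolded 1] add.assoc two add_0_right)
          then show False using gs fresh(3)[OF T] 1 by simp
        next
          case 2
          have "W m \<subseteq> W T"
            unfolding W_def V_def using 2 tr by (intro finite_sums_mono) (auto dest: transD)
          then have "a T \<in> W T" unfolding eq using gs b_W[OF 2] by (auto intro: W_add)
          then show False using fresh(1)[OF T] by blast
        next
          case 3
          have "b m \<in> W m" using cancel[OF _ gs] eq a_W[OF 3] by simp
          then show False using fresh mT by blast
        qed
      qed
      moreover have "c T \<in> T" using c[of T] T by (auto simp: ok_def)
      ultimately show ?thesis by (intro bexI[of _ "c T"]) (auto simp: case_prod_beta)
    qed
  qed
qed

section \<open>Cylinders and continuity of maps between sequence spaces\<close>

definition cyl :: "nat \<Rightarrow> (nat \<Rightarrow> 'a) \<Rightarrow> (nat \<Rightarrow> 'a) set"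
  where "cyl n x = {y. \<forall>i<n. y i = x i}"

lemma cyl_self [simp]: "x \<in> cyl n x"
  by (simp add: cyl_def)

lemma cyl_antimono: "m \<le> n \<Longrightarrow> cyl n x \<subseteq> cyl m x"
  by (auto simp: cyl_def)

lemma cyl_eq: "y \<in> cyl n x \<Longrightarrow> cyl n y = cyl n x"
  by (auto simp: cyl_def)

lemma cyl_subset: "y \<in> cyl n x \<Longrightarrow> n \<le> m \<Longrightarrow> cyl m y \<subseteq> cyl n x"
  using cyl_antimono cyl_eq by blast

lemma openin_cyl:
  "openin (product_topology (\<lambda>_. discrete_topology UNIV) UNIV) W \<longleftrightarrow> (\<forall>x\<in>W. \<exists>n. cyl n x \<subseteq> W)"
proof (intro iffI ballI)
  fix x assume W: "openin (product_topology (\<lambda>_. discrete_topology UNIV) UNIV) W" "x \<in> W"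
  then obtain U where U: "finite {i. U i \<noteq> (UNIV::'a set)}" "x \<in> Pi\<^sub>E UNIV U" "Pi\<^sub>E UNIV U \<subseteq> W"
    by (auto simp: openin_product_topology_alt)
  obtain n where n: "\<And>i. U i \<noteq> UNIV \<Longrightarrow> i < n"
    using finite_nat_bounded[OF U(1)] by auto
  have "cyl n x \<subseteq> Pi\<^sub>E UNIV U"
  proof
    fix y assume y: "y \<in> cyl n x"
    have "y i \<in> U i" for i
    proof (cases "U i = UNIV")
      case False
      then have "y i = x i" using n y by (simp add: cyl_def)
      then show ?thesis using U(2) by (auto simp: PiE_UNIV_domain)
    qed simp
    then show "y \<in> Pi\<^sub>E UNIV U" by (simp add: PiE_UNIV_domain)
  qed
  with U(3) show "\<exists>n. cyl n x \<subseteq> W" by blast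
next
  assume *: "\<forall>x\<in>W. \<exists>n. cyl n x \<subseteq> W"
  show "openin (product_topology (\<lambda>_. discrete_topology UNIV) UNIV) W"
    unfolding openin_product_topology_alt
  proof
    fix x assume "x \<in> W"
    with * obtain n where n: "cyl n x \<subseteq> W" by blast
    let ?U = "\<lambda>i. if i < n then {x i} else UNIV"
    have "{i \<in> UNIV. ?U i \<noteq> topspace (discrete_topology UNIV)} \<subseteq> {..<n}" by auto
    moreover have "Pi\<^sub>E UNIV ?U = cyl n x"
      by (auto simp: cyl_def PiE_UNIV_domain Pi_iff) (metis singletonD)
    ultimately show "\<exists>U. finite {i \<in> UNIV. U i \<noteq> topspace (discrete_topology UNIV)} \<and>
             (\<forall>i\<in>UNIV. openin (discrete_topology UNIV) (U i)) \<and> x \<in> Pi\<^sub>E UNIV U \<and> Pi\<^sub>E UNIV U \<subseteq> W"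
      using n by (intro exI[of _ ?U]) (auto intro: finite_subset)
  qed
qed

definition cyl_open :: "(nat \<Rightarrow> 'a) set \<Rightarrow> bool"
  where "cyl_open W \<longleftrightarrow> (\<forall>x\<in>W. \<exists>n. cyl n x \<subseteq> W)"

definition cont_on :: "(nat \<Rightarrow> 'a) set \<Rightarrow> ((nat \<Rightarrow> 'a) \<Rightarrow> (nat \<Rightarrow> 'b)) \<Rightarrow> bool"
  where "cont_on P g \<longleftrightarrow> (\<forall>a\<in>P. \<forall>n. \<exists>m. g ` (P \<inter> cyl m a) \<subseteq> cyl n (g a))"

lemma cyl_open_Int_cyl:
  assumes "cyl_open A"
  shows "cyl_open (A \<inter> cyl m y)"
  unfolding cyl_open_def
proof
  fix a assume a: "a \<in> A \<inter> cyl m y"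
  then obtain n where n: "cyl n a \<subseteq> A" using assms unfolding cyl_open_def by blast
  have "cyl (max n m) a \<subseteq> cyl n a" "cyl (max n m) a \<subseteq> cyl m y"
    using a by (intro cyl_antimono cyl_subset; simp)+
  with n show "\<exists>n. cyl n a \<subseteq> A \<inter> cyl m y" by blast
qed

lemma cont_onI:
  assumes "\<And>a i. a \<in> P \<Longrightarrow> \<exists>m. \<forall>b \<in> P \<inter> cyl m a. g b i = g a i"
  shows "cont_on P g"
  unfolding cont_on_def
proof (intro ballI allI)
  fix a n assume a: "a \<in> P"
  obtain m where m: "\<And>i b. b \<in> P \<Longrightarrow> b \<in> cyl (m i) a \<Longrightarrow> g b i = g a i"
    using assms[OF a] by (metis IntI)
  define k where "k = Max (insert 0 (m ` {..<n}))"
  have k: "m i \<le> k" if "i < n" for i using that by (simp add: k_def)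
  have "g b \<in> cyl n (g a)" if b: "b \<in> P" "b \<in> cyl k a" for b
    unfolding cyl_def[of n]
  proof (intro CollectI allI impI)
    fix i assume "i < n"
    then show "g b i = g a i" using m b cyl_antimono[OF k] by blast
  qed
  then show "\<exists>m. g ` (P \<inter> cyl m a) \<subseteq> cyl n (g a)" by blast
qed

lemma cont_on_subset: "cont_on P g \<Longrightarrow> Q \<subseteq> P \<Longrightarrow> cont_on Q g"
  unfolding cont_on_def by (meson Int_mono image_mono order_refl order_trans subsetD)

lemma cont_on_comp:
  assumes "cont_on P g" "cont_on UNIV h"
  shows "cont_on P (\<lambda>x. h (g x))"
  unfolding cont_on_def
proof (intro ballI allI)
  fix a n assume "a \<in> P"
  obtain m where m: "h ` (UNIV \<inter> cyl m (g a)) \<subseteq> cyl n (h (g a))"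
    using assms(2) unfolding cont_on_def by blast
  obtain k where "g ` (P \<inter> cyl k a) \<subseteq> cyl m (g a)"
    using assms(1) \<open>a \<in> P\<close> unfolding cont_on_def by blast
  with m show "\<exists>k. (\<lambda>x. h (g x)) ` (P \<inter> cyl k a) \<subseteq> cyl n (h (g a))" by blast
qed

lemma openin_cylD:
  assumes "openin (product_topology (\<lambda>_. discrete_topology UNIV) UNIV) W" "x \<in> W"
  shows "\<exists>n. cyl n x \<subseteq> W"
  using assms unfolding openin_cyl by simp

lemma continuous_map_cyl:
  fixes g :: "(nat \<Rightarrow> 'a) \<Rightarrow> (nat \<Rightarrow> 'b)"
  shows "continuous_map (subtopology (product_topology (\<lambda>_. discrete_topology UNIV) UNIV) P)
     (product_topology (\<lambda>_. discrete_topology UNIV) UNIV) g \<longleftrightarrow> cont_on P g"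
proof
  assume *: "continuous_map (subtopology (product_topology (\<lambda>_. discrete_topology UNIV) UNIV) P)
     (product_topology (\<lambda>_. discrete_topology UNIV) UNIV) g"
  show "cont_on P g"
    unfolding cont_on_def
  proof (intro ballI allI)
    fix a n assume a: "a \<in> P"
    have "openin (product_topology (\<lambda>_. discrete_topology UNIV) UNIV) (cyl n (g a))"
      unfolding openin_cyl by (metis cyl_eq order_refl)
    with * have "openin (subtopology (product_topology (\<lambda>_. discrete_topology UNIV) UNIV) P)
        {x \<in> P. g x \<in> cyl n (g a)}"
      using openin_continuous_map_preimage by fastforce
    then obtain T where T: "openin (product_topology (\<lambda>_. discrete_topology UNIV) UNIV) T"
        "{x \<in> P. g x \<in> cyl n (g a)} = T \<inter> P"
      by (auto simp: openin_subtopology)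
    have "a \<in> T" using T(2) a cyl_self by blast
    then obtain m where "cyl m a \<subseteq> T" using openin_cylD[OF T(1)] by blast
    then show "\<exists>m. g ` (P \<inter> cyl m a) \<subseteq> cyl n (g a)" using T(2) by blast
  qed
next
  assume *: "cont_on P g"
  show "continuous_map (subtopology (product_topology (\<lambda>_. discrete_topology UNIV) UNIV) P)
     (product_topology (\<lambda>_. discrete_topology UNIV) UNIV) g"
    unfolding continuous_map_def
  proof (intro conjI allI impI)
    fix W :: "(nat \<Rightarrow> 'b) set" assume W: "openin (product_topology (\<lambda>_. discrete_topology UNIV) UNIV) W"
    define T where "T = \<Union>{cyl m a |m a. g ` (P \<inter> cyl m a) \<subseteq> W}"
    have "openin (product_topology (\<lambda>_. discrete_topology UNIV) UNIV) T"
      unfolding openin_cyl T_def using cyl_eq by blast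
    moreover have "{x \<in> P. g x \<in> W} = T \<inter> P"
    proof -
      have "x \<in> T" if x: "x \<in> P" "g x \<in> W" for x
      proof -
        obtain n where "cyl n (g x) \<subseteq> W" using openin_cylD[OF W x(2)] by blast
        then obtain m where "g ` (P \<inter> cyl m x) \<subseteq> W" using * x(1) unfolding cont_on_def by (meson order_trans)
        then show ?thesis unfolding T_def using cyl_self by blast
      qed
      then show ?thesis unfolding T_def by blast
    qed
    ultimately show "openin (subtopology (product_topology (\<lambda>_. discrete_topology UNIV) UNIV) P)
          {x \<in> topspace (subtopology (product_topology (\<lambda>_. discrete_topology UNIV) UNIV) P). g x \<in> W}"
      by (auto simp: openin_subtopology)
  qed auto
qed

section \<open>Cantor schemes\<close>

text \<open>
  A tree of cylinders in which the two children of a node are related by \<open>R\<close> and the cylinders of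
  level \<open>k + 1\<close> lie in \<open>U k\<close>. Distinct branches part at some node, and since
  \<open>R\<close> holds between whole cylinders there, it is enough to treat siblings.
\<close>

lemma cantor_scheme:
  fixes U :: "nat \<Rightarrow> (nat \<Rightarrow> 'a) set" and R :: "(nat \<Rightarrow> 'a) \<Rightarrow> (nat \<Rightarrow> 'a) \<Rightarrow> bool"
  defines "P \<equiv> \<Inter>k. U k"
  assumes ne: "P \<noteq> {}" and U: "\<And>k. cyl_open (U k)"
    and R_open: "\<And>a b. a \<in> P \<Longrightarrow> b \<in> P \<Longrightarrow> R a b \<Longrightarrow>
      \<exists>n. \<forall>x \<in> P \<inter> cyl n a. \<forall>y \<in> P \<inter> cyl n b. R x y"
    and R_dense: "\<And>a n. a \<in> P \<Longrightarrow> \<exists>b \<in> P \<inter> cyl n a. \<exists>c \<in> P \<inter> cyl n a. R b c"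
    and R_sym: "\<And>x y. R x y \<Longrightarrow> R y x"
  shows "\<exists>e :: (nat \<Rightarrow> bool) \<Rightarrow> (nat \<Rightarrow> 'a). range e \<subseteq> P \<and> (\<forall>s t. s \<noteq> t \<longrightarrow> R (e s) (e t))"
proof -
  \<comment> \<open>A node is a pair of a point of \<open>P\<close> and the length of the cylinder around it; \<open>f\<close> assigns to it its two children.\<close>
  define good where "good k p f \<longleftrightarrow>
    (\<forall>j::bool. fst (f j) \<in> P \<inter> cyl (snd p) (fst p) \<and> snd (f j) > snd p \<and> cyl (snd (f j)) (fst (f j)) \<subseteq> U k) \<and>
    (\<forall>x \<in> P \<inter> cyl (snd (f True)) (fst (f True)). \<forall>y \<in> P \<inter> cyl (snd (f False)) (fst (f False)). R x y)"
    for k :: nat and p :: "(nat \<Rightarrow> 'a) \<times> nat" and f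
  have ex: "\<exists>f. good k p f" if "fst p \<in> P" for k p
  proof -
    obtain a n where p: "p = (a, n)" by force
    have "a \<in> P" using that by (simp add: p)
    then obtain b c where bc: "b \<in> P" "c \<in> P" "b \<in> cyl n a" "c \<in> cyl n a" "R b c"
      using R_dense[of a n] by blast
    obtain l where l: "\<forall>x \<in> P \<inter> cyl l b. \<forall>y \<in> P \<inter> cyl l c. R x y"
      using R_open bc by blast
    have "b \<in> U k" "c \<in> U k" using bc by (auto simp: P_def)
    then obtain mb mc where m: "cyl mb b \<subseteq> U k" "cyl mc c \<subseteq> U k"
      using U unfolding cyl_open_def by meson
    define h where "h = Max {Suc n, l, mb, mc}"
    have h: "h > n" "h \<ge> l" "h \<ge> mb" "h \<ge> mc" by (auto simp: h_def)
    have lR: "R x y" if "x \<in> P" "x \<in> cyl h b" "y \<in> P" "y \<in> cyl h c" for x y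
      using l cyl_antimono[OF h(2)] that by blast
    have "good k p (\<lambda>j. (if j then b else c, h))"
      unfolding good_def p
      using bc h lR m cyl_antimono[OF h(3), of b] cyl_antimono[OF h(4), of c]
      by (auto simp: all_bool_eq)
    then show ?thesis by blast
  qed
  define step where "step k p = (SOME f. good k p f)" for k p
  have step: "good k p (step k p)" if "fst p \<in> P" for k p
    unfolding step_def using ex[OF that] by (rule someI_ex)
  obtain x0 where x0: "x0 \<in> P" using ne by blast
  define sch where "sch s = rec_nat (x0, 0) (\<lambda>k p. step k p (s k))" for s :: "nat \<Rightarrow> bool"
  have sch_0: "sch s 0 = (x0, 0)" and sch_Suc: "sch s (Suc k) = step k (sch s k) (s k)" for s k
    by (simp_all add: sch_def)
  have sch_P: "fst (sch s k) \<in> P" for s k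
  proof (induction k)
    case (Suc k)
    then show ?case using step[of "sch s k" k] by (simp add: sch_Suc good_def)
  qed (simp add: sch_0 x0)
  define B where "B s k = cyl (snd (sch s k)) (fst (sch s k))" for s k
  have len: "k \<le> snd (sch s k)" for s k
  proof (induction k)
    case (Suc k)
    have "snd (sch s k) < snd (sch s (Suc k))"
      using step[OF sch_P, of k s k] by (simp add: sch_Suc good_def)
    with Suc show ?case by simp
  qed simp
  have B_Suc: "B s (Suc k) \<subseteq> B s k" for s k
    using step[OF sch_P, of k s k] unfolding B_def sch_Suc good_def
    by (intro cyl_subset) (auto simp: less_imp_le)
  have B_O: "B s (Suc k) \<subseteq> U k" for s k
    using step[OF sch_P, of k s k] unfolding B_def sch_Suc good_def by blast
  have B_mono: "B s l \<subseteq> B s k" if "k \<le> l" for s k l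
    using lift_Suc_antimono_le[of "B s", OF B_Suc that] .
  \<comment> \<open>The cylinder at level \<open>Suc i\<close> has length greater than \<open>i\<close>, so it fixes the bit \<open>i\<close> of the branch.\<close>
  define e where "e s i = fst (sch s (Suc i)) i" for s i
  have e_B: "e s \<in> B s k" for s k
    unfolding B_def cyl_def
  proof (intro CollectI allI impI)
    fix i assume i: "i < snd (sch s k)"
    show "e s i = fst (sch s k) i"
    proof (cases "Suc i \<le> k")
      case True
      have "fst (sch s k) \<in> B s k" by (simp add: B_def)
      then have "fst (sch s k) \<in> B s (Suc i)" using B_mono[OF True] by blast
      then show ?thesis using len[of "Suc i" s] by (simp add: B_def cyl_def e_def)
    next
      case False
      have "fst (sch s (Suc i)) \<in> B s (Suc i)" by (simp add: B_def)
      then have "fst (sch s (Suc i)) \<in> B s k" using B_mono[of k "Suc i"] False by auto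
      then show ?thesis using i by (simp add: B_def cyl_def e_def)
    qed
  qed
  have e_P: "e s \<in> P" for s
    unfolding P_def using e_B B_O by blast
  have "R (e s) (e t)" if "s \<noteq> t" for s t
  proof -
    define k where "k = (LEAST k. s k \<noteq> t k)"
    have k: "s k \<noteq> t k" "\<And>i. i < k \<Longrightarrow> s i = t i"
    proof -
      have "\<exists>k. s k \<noteq> t k" using that by auto
      then show "s k \<noteq> t k" unfolding k_def by (rule LeastI_ex)
      show "s i = t i" if "i < k" for i
        using not_less_Least[OF that[unfolded k_def]] by simp
    qed
    have "sch s j = sch t j" if "j \<le> k" for j
      using that by (induction j) (auto simp: sch_0 sch_Suc k)
    then have eq: "sch s k = sch t k" by simp
    have *: "R (e u) (e w)" if "u k" "\<not> w k" "sch u k = sch w k" for u w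
    proof -
      let ?f = "step k (sch u k)"
      have "e u \<in> cyl (snd (?f True)) (fst (?f True))"
        using e_B[of u "Suc k"] that(1) by (simp add: B_def sch_Suc)
      moreover have "e w \<in> cyl (snd (?f False)) (fst (?f False))"
        using e_B[of w "Suc k"] that(2,3) by (simp add: B_def sch_Suc)
      ultimately show ?thesis
        using step[OF sch_P[of u k], of k, unfolded good_def, THEN conjunct2] e_P[of u] e_P[of w]
        by simp
    qed
    show ?thesis
    proof (cases "s k")
      case True
      then show ?thesis using *[of s t] k(1) eq by blast
    next
      case False
      then show ?thesis using R_sym[OF *[of t s]] k(1) eq by simp
    qed
  qed
  then show ?thesis using e_P by blast
qed

lemma cont_on_neq:
  assumes "cont_on P g" "a \<in> P" "b \<in> P" "g a \<noteq> g b"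
  shows "\<exists>m. \<forall>x \<in> P \<inter> cyl m a. \<forall>y \<in> P \<inter> cyl m b. g x \<noteq> g y"
proof -
  obtain i where i: "g a i \<noteq> g b i" using assms(4) by auto
  obtain m k where m: "g ` (P \<inter> cyl m a) \<subseteq> cyl (Suc i) (g a)" "g ` (P \<inter> cyl k b) \<subseteq> cyl (Suc i) (g b)"
    using assms unfolding cont_on_def by meson
  have "g x \<noteq> g y" if "x \<in> P \<inter> cyl (max m k) a" "y \<in> P \<inter> cyl (max m k) b" for x y
  proof -
    have "g x \<in> cyl (Suc i) (g a)" "g y \<in> cyl (Suc i) (g b)"
      using m that cyl_antimono[of m "max m k" a] cyl_antimono[of k "max m k" b] by force+
    then have "g x i = g a i" "g y i = g b i" by (auto simp: cyl_def)
    with i show ?thesis by auto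
  qed
  then show ?thesis by blast
qed

text \<open>
  Let \<open>R x y\<close> say that every function in \<open>Gs\<close> separates \<open>x\<close> from
  \<open>y\<close>. As the functions are nowhere locally constant, any point can be separated from some point
  nearby, by treating one function after the other. A Cantor scheme for \<open>R\<close> carries continuum many
  points on which each function is injective; each function takes values in \<open>V\<close> at fewer than
  continuum many of them, and \<open>Gs\<close> is finite.
\<close>

lemma avoid_small_set:
  fixes U :: "nat \<Rightarrow> (nat \<Rightarrow> 'a) set" and Gs :: "((nat \<Rightarrow> 'a) \<Rightarrow> (nat \<Rightarrow> 'b)) set"
  defines "P \<equiv> \<Inter>k. U k"
  assumes ne: "P \<noteq> {}" and U: "\<And>k. cyl_open (U k)"
    and Gs: "finite Gs" "\<And>g. g \<in> Gs \<Longrightarrow> cont_on P g"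
    and nonconst: "\<And>g a n. g \<in> Gs \<Longrightarrow> a \<in> P \<Longrightarrow> \<exists>b \<in> P \<inter> cyl n a. g b \<noteq> g a"
    and V: "V \<prec> (UNIV :: (nat \<Rightarrow> bool) set)"
  shows "\<exists>a\<in>P. \<forall>g\<in>Gs. g a \<notin> V"
proof -
  define R where "R a b \<longleftrightarrow> (\<forall>g\<in>Gs. g a \<noteq> g b)" for a b
  have R_sym: "R y x" if "R x y" for x y
    using that unfolding R_def by metis
  have R_open: "\<exists>n. \<forall>x \<in> P \<inter> cyl n a. \<forall>y \<in> P \<inter> cyl n b. R x y" if "a \<in> P" "b \<in> P" "R a b" for a b
  proof -
    have "\<forall>g\<in>Gs. \<exists>m. \<forall>x \<in> P \<inter> cyl m a. \<forall>y \<in> P \<inter> cyl m b. g x \<noteq> g y"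
      using that Gs cont_on_neq unfolding R_def by blast
    then obtain m where m: "\<And>g x y. g \<in> Gs \<Longrightarrow> x \<in> P \<inter> cyl (m g) a \<Longrightarrow> y \<in> P \<inter> cyl (m g) b \<Longrightarrow> g x \<noteq> g y"
      by metis
    have "m g \<le> Max (m ` Gs)" if "g \<in> Gs" for g using that Gs by simp
    then show ?thesis using m cyl_antimono unfolding R_def
      by (intro exI[of _ "Max (m ` Gs)"]) blast
  qed
  have sep: "\<exists>b\<in>P \<inter> cyl n a. \<forall>g\<in>Hs. g a \<noteq> g b" if a: "a \<in> P" and Hs: "Hs \<subseteq> Gs" for Hs a n
    using finite_subset[OF Hs Gs(1)] Hs
  proof (induction Hs rule: finite_induct)
    case empty
    then show ?case using a by (intro bexI[of _ a]) auto
  next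
    case (insert h Hs)
    then obtain b where b: "b \<in> P" "b \<in> cyl n a" "\<forall>g\<in>Hs. g a \<noteq> g b" by auto
    have "\<forall>g\<in>Hs. \<exists>m. \<forall>y \<in> P \<inter> cyl m b. g a \<noteq> g y"
    proof
      fix g assume "g \<in> Hs"
      then show "\<exists>m. \<forall>y \<in> P \<inter> cyl m b. g a \<noteq> g y"
        using cont_on_neq[OF Gs(2) a b(1), of g] insert.prems a b(3) by (blast intro: cyl_self)
    qed
    then obtain m where m: "\<And>g y. g \<in> Hs \<Longrightarrow> y \<in> P \<inter> cyl (m g) b \<Longrightarrow> g a \<noteq> g y"
      by metis
    define k where "k = Max (insert n (m ` Hs))"
    have k: "n \<le> k" "\<And>g. g \<in> Hs \<Longrightarrow> m g \<le> k" using insert.hyps by (auto simp: k_def)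
    have near: "y \<in> cyl n a \<and> (\<forall>g\<in>Hs. g a \<noteq> g y)" if "y \<in> P \<inter> cyl k b" for y
      using that m k cyl_antimono cyl_subset[OF b(2) k(1)] by blast
    show ?case
    proof (cases "h a = h b")
      case False
      then show ?thesis using b by auto
    next
      case True
      obtain c where "c \<in> P \<inter> cyl k b" "h c \<noteq> h b"
        using nonconst insert.prems b by blast
      \<comment> \<open>As \<open>h c\<close> differs from \<open>h b = h a\<close>, passing from \<open>b\<close> to \<open>c\<close> repairs the one function that failed to separate.\<close>
      then show ?thesis using near[of c] True by (intro bexI[of _ c]) auto
    qed
  qed
  have "\<exists>e :: (nat \<Rightarrow> bool) \<Rightarrow> (nat \<Rightarrow> 'a). range e \<subseteq> P \<and> (\<forall>s t. s \<noteq> t \<longrightarrow> R (e s) (e t))"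
    unfolding P_def
  proof (rule cantor_scheme[OF ne[unfolded P_def] U])
    show "\<exists>b\<in>\<Inter> (range U) \<inter> cyl n a. \<exists>c\<in>\<Inter> (range U) \<inter> cyl n a. R b c"
      if "a \<in> \<Inter> (range U)" for a n
      using sep[of a Gs n] that unfolding P_def R_def by (blast intro: cyl_self)
    show "\<exists>n. \<forall>x \<in> \<Inter> (range U) \<inter> cyl n a. \<forall>y \<in> \<Inter> (range U) \<inter> cyl n b. R x y"
      if "a \<in> \<Inter> (range U)" "b \<in> \<Inter> (range U)" "R a b" for a b
      using R_open[unfolded P_def, OF that] .
  qed (fact R_sym)
  then obtain e :: "(nat \<Rightarrow> bool) \<Rightarrow> nat \<Rightarrow> 'a"
    where e: "range e \<subseteq> P" "\<And>s t g. s \<noteq> t \<Longrightarrow> g \<in> Gs \<Longrightarrow> g (e s) \<noteq> g (e t)"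
    unfolding R_def by blast
  have bad: "{s. g (e s) \<in> V} \<prec> (UNIV :: (nat \<Rightarrow> bool) set)" if "g \<in> Gs" for g
  proof -
    have "inj_on (\<lambda>s. g (e s)) {s. g (e s) \<in> V}" using e(2) that by (meson inj_onI)
    then have "{s. g (e s) \<in> V} \<lesssim> V" unfolding lepoll_def by blast
    then show ?thesis using V lesspoll_trans1 by blast
  qed
  have inf: "infinite (UNIV :: (nat \<Rightarrow> bool) set)"
    by (simp add: finite_fun_UNIVD1 finite_fun_UNIVD2 finite_UNIV_fun)
  have "(\<Union>g\<in>Hs. {s. g (e s) \<in> V}) \<prec> (UNIV :: (nat \<Rightarrow> bool) set)" if "Hs \<subseteq> Gs" for Hs
    using finite_subset[OF that Gs(1)] that
  proof (induction Hs rule: finite_induct)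
    case empty
    then show ?case using inf by (simp add: finite_lesspoll_infinite)
  next
    case (insert h Hs)
    then show ?case using Un_lesspoll[OF inf bad[of h]] by simp
  qed
  then have "(\<Union>g\<in>Gs. {s. g (e s) \<in> V}) \<noteq> (UNIV :: (nat \<Rightarrow> bool) set)"
    by (metis lesspoll_not_refl order_refl)
  then show ?thesis using e(1) by blast
qed

section \<open>Eventually constant sequences and the group of bit sequences\<close>

abbreviation Bit_space :: "(nat \<Rightarrow> bit) topology"
  where "Bit_space \<equiv> product_topology (\<lambda>_. discrete_topology UNIV) UNIV"

definition ev_const :: "'a \<Rightarrow> (nat \<Rightarrow> 'a) set"
  where "ev_const z = {u. \<exists>N. \<forall>n\<ge>N. u n = z}"

lemma ev_const_dense: "\<exists>y \<in> ev_const z. y \<in> cyl n x"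
proof
  show "(\<lambda>i. if i < n then x i else z) \<in> ev_const z"
    unfolding ev_const_def by (intro CollectI exI[of _ n]) simp
qed (simp add: cyl_def)

lemma countable_ev_const_bool: "countable (ev_const (z::bool))"
proof -
  have "u \<in> range (\<lambda>xs i. if i < length xs then xs ! i else z)" if "u \<in> ev_const z" for u
  proof -
    obtain N where "\<forall>n\<ge>N. u n = z" using \<open>u \<in> ev_const z\<close> by (auto simp: ev_const_def)
    then have "u = (\<lambda>i. if i < length (map u [0..<N]) then map u [0..<N] ! i else z)"
      by (auto simp: fun_eq_iff)
    then show ?thesis by blast
  qed
  then have "ev_const z \<subseteq> range (\<lambda>xs i. if i < length xs then xs ! i else z)" by blast
  then show ?thesis by (rule countable_subset) simp
qed

lemma countable_ev_const_bit: "countable (ev_const (z::bit))"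
proof -
  have "c \<in> (\<lambda>u. of_bool \<circ> u) ` ev_const (z = 1)" if "c \<in> ev_const z" for c :: "nat \<Rightarrow> bit"
  proof (rule image_eqI)
    show "(\<lambda>n. c n = 1) \<in> ev_const (z = 1)" using that by (auto simp: ev_const_def)
    show "c = of_bool \<circ> (\<lambda>n. c n = 1)" by (auto simp: fun_eq_iff)
  qed
  then have "ev_const z \<subseteq> (\<lambda>u. of_bool \<circ> u :: nat \<Rightarrow> bit) ` ev_const (z = 1)" by blast
  then show ?thesis by (rule countable_subset) (intro countable_image countable_ev_const_bool)
qed

lemma bit_seq_add_self [simp]: "(x::nat \<Rightarrow> bit) + x = 0"
proof
  fix n show "(x + x) n = 0 n" by (cases "x n") auto
qed

lemma ev_const_add: "x \<in> ev_const (a::bit) \<Longrightarrow> y \<in> ev_const b \<Longrightarrow> x + y \<in> ev_const (a + b)"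
proof -
  assume "x \<in> ev_const a" "y \<in> ev_const b"
  then obtain M N where "\<forall>n\<ge>M. x n = a" "\<forall>n\<ge>N. y n = b" by (auto simp: ev_const_def)
  then have "\<forall>n\<ge>max M N. (x + y) n = a + b" by simp
  then show ?thesis unfolding ev_const_def by blast
qed

lemma cont_on_add:
  fixes g h :: "(nat \<Rightarrow> 'a) \<Rightarrow> nat \<Rightarrow> bit"
  assumes "cont_on P g" "cont_on P h"
  shows "cont_on P (\<lambda>x. g x + h x)"
  unfolding cont_on_def
proof (intro ballI allI)
  fix a n assume a: "a \<in> P"
  obtain m k where m: "g ` (P \<inter> cyl m a) \<subseteq> cyl n (g a)" and k: "h ` (P \<inter> cyl k a) \<subseteq> cyl n (h a)"
    using assms a unfolding cont_on_def by meson
  have "g x + h x \<in> cyl n (g a + h a)" if "x \<in> P" "x \<in> cyl (max m k) a" for x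
  proof -
    have "x \<in> cyl m a" "x \<in> cyl k a"
      using that cyl_antimono[of m "max m k" a] cyl_antimono[of k "max m k" a] by auto
    then have "g x \<in> cyl n (g a)" "h x \<in> cyl n (h a)" using m k that by blast+
    then show ?thesis by (simp add: cyl_def)
  qed
  then show "\<exists>m. (\<lambda>x. g x + h x) ` (P \<inter> cyl m a) \<subseteq> cyl n (g a + h a)" by blast
qed

lemma two_ev_const_in_cyl: "\<exists>d e. d \<in> ev_const (0::bit) \<inter> cyl n c \<and> e \<in> ev_const 0 \<inter> cyl n c \<and> d \<noteq> e"
proof -
  obtain d where d: "d \<in> ev_const 0" "d \<in> cyl n c" using ev_const_dense[of 0 n c] by blast
  obtain e where e: "e \<in> ev_const 0" "e \<in> cyl (Suc n) (c(n := d n + 1))"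
    using ev_const_dense[of 0 "Suc n" "c(n := d n + 1)"] by blast
  have "e n = d n + 1" "e \<in> cyl n c" using e(2) by (auto simp: cyl_def)
  moreover have "d n + 1 \<noteq> d n" by (cases "d n") auto
  ultimately show ?thesis using d e(1) by (metis IntI)
qed

section \<open>A surjection of the Cantor space that splits countably many points\<close>

definition scons :: "'a \<Rightarrow> (nat \<Rightarrow> 'a) \<Rightarrow> nat \<Rightarrow> 'a"  (infixr "##" 65)
  where "a ## u = case_nat a u"

lemma scons_0 [simp]: "(a ## u) 0 = a" and scons_Suc [simp]: "(a ## u) (Suc n) = u n"
  by (simp_all add: scons_def)

lemma ev_const_scons [simp]: "a ## u \<in> ev_const z \<longleftrightarrow> u \<in> ev_const z"
proof
  assume "a ## u \<in> ev_const z"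
  then obtain N where N: "\<forall>n\<ge>N. (a ## u) n = z" by (auto simp: ev_const_def)
  have "u n = z" if "n \<ge> N" for n using N[rule_format, of "Suc n"] that by simp
  then show "u \<in> ev_const z" by (auto simp: ev_const_def)
next
  assume "u \<in> ev_const z"
  then obtain N where N: "\<forall>n\<ge>N. u n = z" by (auto simp: ev_const_def)
  have "(a ## u) n = z" if "n \<ge> Suc N" for n using N that by (cases n) auto
  then show "a ## u \<in> ev_const z" by (auto simp: ev_const_def)
qed

lemma scons_eq_iff [simp]: "a ## u = b ## w \<longleftrightarrow> a = b \<and> u = w"
  by (metis ext scons_0 scons_Suc)

lemma stream_cases:
  obtains a w where "u = a ## w"
proof -
  have "u = u 0 ## (\<lambda>n. u (Suc n))" by (auto simp: scons_def split: nat.splits)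
  then show ?thesis using that by blast
qed

lemma ev_const_induct [consumes 1, case_names const cons]:
  assumes "u \<in> ev_const z" "Q (\<lambda>_. z)" "\<And>a u. u \<in> ev_const z \<Longrightarrow> Q u \<Longrightarrow> Q (a ## u)"
  shows "Q u"
proof -
  have "u \<in> ev_const z \<Longrightarrow> \<forall>n\<ge>N. u n = z \<Longrightarrow> Q u" for N
  proof (induction N arbitrary: u)
    case 0
    then have "u = (\<lambda>_. z)" by auto
    then show ?case using assms(2) by simp
  next
    case (Suc N)
    obtain a w where u: "u = a ## w" by (rule stream_cases)
    have "\<forall>n\<ge>N. w n = z" using Suc.prems(2) by (auto simp: u dest: spec[of _ "Suc _"])
    moreover have "w \<in> ev_const z" using Suc.prems(1) by (simp add: u)
    ultimately show ?case unfolding u using Suc.IH assms(3) by blast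
  qed
  then show ?thesis using assms(1) by (auto simp: ev_const_def)
qed

lemma const_ev_const [simp]: "(\<lambda>_. z) \<in> ev_const z"
  by (simp add: ev_const_def)

text \<open>
  A sequence with infinitely many ones is a concatenation of blocks \<open>0\<^sup>g1\<close>. Writing \<open>g =
  2m + p\<close> with \<open>p < 2\<close>, encode such a block by the word \<open>p0\<^sup>m1\<close>. Decoding
  is \<open>collapse\<close>: it reads the parity bit of a block, emits a \<open>0\<close> if the bit is set, and
  hands over to \<open>even_collapse\<close>, which emits \<open>00\<close> for each zero and \<open>1\<close> at
  the end of the block. A last, infinite block has no parity, so both of its encodings are decoded to the same
  sequence; this splits exactly the sequences that are eventually \<open>0\<close>. The mutual recursion is
  unrolled by one step; \<open>collapse_scons\<close> and \<open>even_collapse_scons\<close> are the intended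
  equations.
\<close>

fun even_collapse :: "(nat \<Rightarrow> bool) \<Rightarrow> nat \<Rightarrow> bit" where
  "even_collapse u 0 = of_bool (u 0)"
| "even_collapse u (Suc n) =
    (if u 0 then
       if u 1 then case n of 0 \<Rightarrow> 0 | Suc m \<Rightarrow> even_collapse (\<lambda>i. u (Suc (Suc i))) m
       else even_collapse (\<lambda>i. u (Suc (Suc i))) n
     else case n of 0 \<Rightarrow> 0 | Suc m \<Rightarrow> even_collapse (\<lambda>i. u (Suc i)) m)"

definition collapse :: "(nat \<Rightarrow> bool) \<Rightarrow> nat \<Rightarrow> bit" where
  "collapse u = (if u 0 then 0 ## (even_collapse (\<lambda>i. u (Suc i))) else even_collapse (\<lambda>i. u (Suc i)))"

lemma collapse_scons [simp]:
  "collapse (True ## u) = 0 ## even_collapse u"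
  "collapse (False ## u) = even_collapse u"
  by (simp_all add: collapse_def)

declare even_collapse.simps [simp del]

lemma even_collapse_scons [simp]:
  "even_collapse (True ## u) = 1 ## collapse u"
  "even_collapse (False ## u) = 0 ## 0 ## even_collapse u"
proof -
  show "even_collapse (True ## u) = 1 ## collapse u"
  proof
    fix n show "even_collapse (True ## u) n = (1 ## collapse u) n"
      by (cases n) (auto simp: collapse_def even_collapse.simps scons_def split: nat.splits)
  qed
  show "even_collapse (False ## u) = 0 ## 0 ## even_collapse u"
  proof
    fix n show "even_collapse (False ## u) n = (0 ## 0 ## even_collapse u) n"
      by (cases n) (auto simp: even_collapse.simps split: nat.splits)
  qed
qed

text \<open>
  Every input bit other than a parity bit produces output, so input is read at most twice as fast as output is
  written, which makes decoding continuous.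
\<close>

lemma even_collapse_local: "w \<in> cyl (2 * n + 1) u \<Longrightarrow> even_collapse w n = even_collapse u n"
proof (induction u n arbitrary: w rule: even_collapse.induct)
  case (1 u)
  then show ?case by (simp add: cyl_def even_collapse.simps)
next
  case (2 u n)
  have w: "w 0 = u 0" "w 1 = u 1" using "2.prems" by (auto simp: cyl_def)
  have t1: "(\<lambda>i. w (Suc i)) \<in> cyl (2 * m + 1) (\<lambda>i. u (Suc i))" if "n = Suc m" for m
    using "2.prems" that by (auto simp: cyl_def)
  have t2: "(\<lambda>i. w (Suc (Suc i))) \<in> cyl (2 * m + 1) (\<lambda>i. u (Suc (Suc i)))" if "m \<le> n" for m
    using "2.prems" that by (auto simp: cyl_def)
  show ?case
  proof (cases n)
    case 0
    then show ?thesis using "2.IH"(2)[OF _ _ t2[of n]] w by (simp add: even_collapse.simps(2))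
  next
    case (Suc m)
    then show ?thesis
      using "2.IH"(1)[OF _ _ Suc t2[of m]] "2.IH"(2)[OF _ _ t2[of n]] "2.IH"(3)[OF _ Suc t1[OF Suc]] w
      by (simp add: even_collapse.simps(2))
  qed
qed

lemma collapse_local: "w \<in> cyl (2 * n + 2) u \<Longrightarrow> collapse w n = collapse u n"
proof -
  assume w: "w \<in> cyl (2 * n + 2) u"
  then have 0: "w 0 = u 0" by (simp add: cyl_def)
  have "even_collapse (\<lambda>i. w (Suc i)) m = even_collapse (\<lambda>i. u (Suc i)) m" if "m \<le> n" for m
    using w that by (intro even_collapse_local) (auto simp: cyl_def)
  then show ?thesis using 0 by (cases n) (simp_all add: collapse_def)
qed

lemma collapse_cyl: "collapse ` cyl (2 * n) u \<subseteq> cyl n (collapse u)"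
proof -
  have local: "collapse w i = collapse u i" if "w \<in> cyl (2 * n) u" "i < n" for w i
    using that cyl_antimono[of "2 * i + 2" "2 * n" u] by (intro collapse_local) auto
  show ?thesis
  proof (rule image_subsetI)
    fix w assume "w \<in> cyl (2 * n) u"
    then show "collapse w \<in> cyl n (collapse u)" unfolding cyl_def[of n] using local by blast
  qed
qed

lemma even_collapse_False: "even_collapse (\<lambda>_. False) = (\<lambda>_. 0)"
proof
  fix n show "even_collapse (\<lambda>_. False) n = 0"
  proof (induction n rule: less_induct)
    case (less n)
    then show ?case by (cases n) (auto simp: even_collapse.simps split: nat.splits)
  qed
qed

lemma scons_const: "z ## (\<lambda>_. z) = (\<lambda>_. z)"
  by (auto simp: scons_def split: nat.splits)

lemma collapse_False: "collapse (\<lambda>_. False) = (\<lambda>_. 0)"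
  by (simp add: collapse_def even_collapse_False)

lemma even_collapse_eq_0: "even_collapse u = (\<lambda>_. 0) \<Longrightarrow> u n = False"
proof (induction n arbitrary: u)
  case 0
  then show ?case using even_collapse.simps(1)[of u] by (auto split: if_splits)
next
  case (Suc n)
  obtain a w where u: "u = a ## w" by (rule stream_cases)
  have "\<not> a" using Suc.prems even_collapse.simps(1)[of u] by (auto simp: u split: if_splits)
  then have "0 ## 0 ## even_collapse w = (\<lambda>_. 0)" using Suc.prems by (simp add: u)
  then have "even_collapse w i = 0" for i by (metis scons_Suc)
  then show ?case using Suc.IH[of w] by (auto simp: u)
qed

lemma ev_const_collapse: "u \<in> ev_const False \<Longrightarrow> even_collapse u \<in> ev_const 0 \<and> collapse u \<in> ev_const 0"
proof (induction rule: ev_const_induct)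
  case const
  then show ?case by (simp add: even_collapse_False collapse_False)
next
  case (cons a u)
  then show ?case by (cases a) auto
qed

lemma ev_const_even_collapseD: "\<forall>n\<ge>N. even_collapse u n = 0 \<Longrightarrow> u \<in> ev_const False"
proof (induction N arbitrary: u)
  case 0
  then have "even_collapse u = (\<lambda>_. 0)" by auto
  then have "u = (\<lambda>_. False)" using even_collapse_eq_0[of u] by auto
  then show ?case by simp
next
  case (Suc N)
  obtain a v where u: "u = a ## v" by (rule stream_cases)
  obtain b w where v: "v = b ## w" by (rule stream_cases)
  have *: "even_collapse u (Suc n) = 0" "even_collapse u (Suc (Suc n)) = 0" if "n \<ge> N" for n
    using Suc.prems that by auto
  show ?case
  proof (cases a)
    case True
    have "\<forall>n\<ge>N. even_collapse w n = 0"
      using * by (cases b) (simp_all add: u v True)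
    then show ?thesis using Suc.IH[of w] by (simp add: u v)
  next
    case False
    have "\<forall>n\<ge>N. even_collapse v n = 0" using * by (simp add: u False)
    then show ?thesis using Suc.IH[of v] by (simp add: u)
  qed
qed

lemma collapse_ev_const_iff: "collapse u \<in> ev_const 0 \<longleftrightarrow> u \<in> ev_const False"
proof
  assume c: "collapse u \<in> ev_const 0"
  obtain a v where u: "u = a ## v" by (rule stream_cases)
  have "even_collapse v \<in> ev_const 0" using c by (cases a) (simp_all add: u)
  then have "v \<in> ev_const False" using ev_const_even_collapseD by (auto simp: ev_const_def)
  then show "u \<in> ev_const False" by (simp add: u)
qed (use ev_const_collapse in blast)

text \<open>
  Both values of \<open>even_collapse\<close> begin with an even number of zeros if they contain a one at all, so
  a shift by one zero is impossible unless everything vanishes. The roles of the two sequences are exchanged at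
  each step of the induction.
\<close>

lemma even_collapse_parity: "even_collapse x = 0 ## even_collapse y \<Longrightarrow> even_collapse x n = 0"
proof (induction n arbitrary: x y)
  case 0
  then show ?case by simp
next
  case (Suc n)
  obtain a w where x: "x = a ## w" by (rule stream_cases)
  have "\<not> a" using Suc.prems by (cases a) (auto simp: x)
  then have "even_collapse y = 0 ## even_collapse w" using Suc.prems by (simp add: x)
  from Suc.IH[OF this] show ?case by (simp add: Suc.prems)
qed

text \<open>
  Parity determines the first input bit of \<open>collapse\<close>, the first output bit that of
  \<open>even_collapse\<close>; the remaining bits follow by passing to the tails, where the two functions
  alternate.
\<close>

lemma collapse_inj_bitwise:
  "(even_collapse u = even_collapse w \<longrightarrow> even_collapse u \<notin> ev_const 0 \<longrightarrow> u n = w n) \<and>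
   (collapse u = collapse w \<longrightarrow> collapse u \<notin> ev_const 0 \<longrightarrow> u n = w n)"
proof (induction n arbitrary: u w rule: less_induct)
  case (less n)
  obtain a u' where u: "u = a ## u'" by (rule stream_cases)
  obtain b w' where w: "w = b ## w'" by (rule stream_cases)
  have tails: "u n = w n" if "a = b" "(even_collapse u' = even_collapse w' \<and> even_collapse u' \<notin> ev_const 0) \<or> (collapse u' = collapse w' \<and> collapse u' \<notin> ev_const 0)"
    using that less.IH[of "n - 1" u' w'] by (cases n) (auto simp: u w)
  have no: "even_collapse x \<in> ev_const 0" if "even_collapse x = 0 ## even_collapse y" for x y
    using even_collapse_parity[OF that] by (auto simp: ev_const_def)
  show ?case
  proof (intro conjI impI)
    assume *: "even_collapse u = even_collapse w" "even_collapse u \<notin> ev_const 0"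
    then show "u n = w n"
      by (cases a; cases b; intro tails) (auto simp: u w)
  next
    assume *: "collapse u = collapse w" "collapse u \<notin> ev_const 0"
    consider "a = b" | "a" "\<not> b" | "\<not> a" "b" by blast
    then show "u n = w n"
    proof cases
      case 1
      with * show ?thesis by (cases a; intro tails) (auto simp: u w)
    next
      case 2
      then show ?thesis using * no[of w' u'] by (simp add: u w)
    next
      case 3
      then show ?thesis using * no[of u' w'] by (simp add: u w)
    qed
  qed
qed

lemma collapse_inj:
  assumes "collapse u = collapse w" "collapse u \<notin> ev_const 0"
  shows "u = w"
  using collapse_inj_bitwise assms by blast

text \<open>
  Prefixing a bit \<open>a\<close> to \<open>d\<close> lifts to an injection \<open>s\<close> on encodings, so the
  two encodings of the zero sequence yield two of every sequence that is eventually \<open>0\<close>. To prefix a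
  zero is to lengthen the first block by one, which either sets its parity bit, or clears it and adds a zero to
  its half-length.
\<close>

lemma collapse_two_preimages:
  assumes "d \<in> ev_const 0"
  shows "\<exists>u w. u \<noteq> w \<and> collapse u = d \<and> collapse w = d"
  using assms
proof (induction rule: ev_const_induct)
  case const
  show ?case
    by (intro exI[of _ "\<lambda>_. False"] exI[of _ "True ## (\<lambda>_. False)"])
      (auto simp: collapse_False even_collapse_False scons_const fun_eq_iff split: nat.splits intro: exI[of _ 0])
next
  case (cons a d)
  then obtain u w where uw: "u \<noteq> w" "collapse u = d" "collapse w = d" by blast
  define s where "s x = (if a = 1 then False ## True ## x
      else if x 0 then False ## (False ## (\<lambda>i. x (Suc i))) else True ## (\<lambda>i. x (Suc i)))"
    for x :: "nat \<Rightarrow> bool"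
  have s: "collapse (s x) = a ## collapse x" for x
    by (rule stream_cases[of x]; cases "x 0") (auto simp: s_def collapse_def)
  have "s u \<noteq> s w"
  proof -
    obtain b u' c w' where "u = b ## u'" "w = c ## w'" by (metis stream_cases)
    then show ?thesis using uw(1) by (auto simp: s_def)
  qed
  then show ?case using s uw by metis
qed

lemma continuous_map_collapse: "continuous_map Cantor_space Bit_space collapse"
proof -
  have "cont_on UNIV collapse"
    unfolding cont_on_def
  proof (intro ballI allI)
    fix a n show "\<exists>m. collapse ` (UNIV \<inter> cyl m a) \<subseteq> cyl n (collapse a)"
      using collapse_cyl[of n a] by (intro exI[of _ "2 * n"]) simp
  qed
  then show ?thesis using continuous_map_cyl[of UNIV collapse] by simp
qed

lemma closed_map_collapse: "closed_map Cantor_space Bit_space collapse"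
  by (intro continuous_imp_closed_map continuous_map_collapse)
    (auto simp: compact_space_product_topology compact_space_discrete_topology
      Hausdorff_space_product_topology Hausdorff_space_discrete_topology)

text \<open>
  The image is compact and contains the dense set of sequences that are eventually \<open>0\<close>.
\<close>

lemma surj_collapse: "surj collapse"
proof -
  have "closedin Bit_space (range collapse)"
    using closed_map_collapse closedin_topspace[of Cantor_space] by (simp add: closed_map_def)
  then have op: "openin Bit_space (- range collapse)"
    by (simp add: closedin_def Compl_eq_Diff_UNIV)
  have "- range collapse = {}"
  proof (rule ccontr)
    assume "- range collapse \<noteq> {}"
    then obtain x where "x \<in> - range collapse" by blast
    then obtain n where x: "cyl n x \<subseteq> - range collapse" using openin_cylD[OF op] by blast
    obtain y where "y \<in> ev_const 0" "y \<in> cyl n x" using ev_const_dense[of 0 n x] by blast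
    with x collapse_two_preimages[of y] show False by blast
  qed
  then show ?thesis by auto
qed

text \<open>
  Irreducibility: a nonempty open set contains the full preimage of a nonempty open set. It contains a point
  \<open>u\<close> that is alone in its fibre, so the compact image of the complement misses \<open>collapse
  u\<close>. The points that are eventually \<open>True\<close> are a convenient dense supply of such
  \<open>u\<close>.
\<close>

lemma collapse_irreducible:
  assumes "a \<in> W" "openin Cantor_space W"
  shows "\<exists>c n. collapse -` cyl n c \<subseteq> W"
proof -
  obtain m where m: "cyl m a \<subseteq> W" using openin_cylD[OF assms(2,1)] by blast
  obtain u where u: "u \<in> ev_const True" "u \<in> cyl m a" using ev_const_dense[of True m a] by blast
  then have "u \<notin> ev_const False" by (auto simp: ev_const_def) (metis max.cobounded1 max.cobounded2)
  then have "collapse u \<notin> ev_const 0" by (simp add: collapse_ev_const_iff)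
  then have out: "collapse u \<notin> collapse ` (- W)" using collapse_inj m u by blast
  have "closedin Cantor_space (- W)" using assms by (simp add: closedin_def Compl_eq_Diff_UNIV double_diff)
  then have "openin Bit_space (- (collapse ` (- W)))"
    using closed_map_collapse unfolding closed_map_def closedin_def by (simp add: Compl_eq_Diff_UNIV)
  from openin_cylD[OF this] out obtain n where "cyl n (collapse u) \<subseteq> - (collapse ` (- W))" by blast
  then show ?thesis by blast
qed

lemma homeomorphic_map_collapse:
  assumes "S \<inter> ev_const 0 = {}"
  shows "homeomorphic_map (subtopology Cantor_space (collapse -` S)) (subtopology Bit_space S) collapse"
proof (rule bijective_closed_imp_homeomorphic_map)
  show "continuous_map (subtopology Cantor_space (collapse -` S)) (subtopology Bit_space S) collapse"
    using continuous_map_collapse by (auto simp: continuous_map_in_subtopology intro: continuous_map_from_subtopology)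
  show "closed_map (subtopology Cantor_space (collapse -` S)) (subtopology Bit_space S) collapse"
    by (rule closed_map_restriction[OF closed_map_collapse]) auto
  show "collapse ` topspace (subtopology Cantor_space (collapse -` S)) = topspace (subtopology Bit_space S)"
    using surj_collapse by (auto simp: surj_def)
  show "inj_on collapse (topspace (subtopology Cantor_space (collapse -` S)))"
    using assms collapse_inj by (auto simp: inj_on_def)
qed

lemma cont_on_collapse: "cont_on P collapse"
proof -
  have "continuous_map (subtopology Cantor_space P) Bit_space collapse"
    by (intro continuous_map_from_subtopology continuous_map_collapse)
  then show ?thesis by (simp only: continuous_map_cyl)
qed

section \<open>Extending a function from a countable dense set\<close>

text \<open>
  The points at which the restriction of \<open>f\<close> to the countable dense set \<open>ev_const False\<close>
  has a limit, and the limit there. Both depend on that restriction only, which bounds the number of such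
  extensions by the continuum (\<open>range_tests_lepoll\<close>).
\<close>

definition limit_dom :: "((nat \<Rightarrow> bool) \<Rightarrow> (nat \<Rightarrow> bool)) \<Rightarrow> (nat \<Rightarrow> bool) set"
  where "limit_dom f = {a. \<forall>n. \<exists>m. \<forall>x \<in> ev_const False \<inter> cyl m a. \<forall>y \<in> ev_const False \<inter> cyl m a. f x n = f y n}"

definition limit_ext :: "((nat \<Rightarrow> bool) \<Rightarrow> (nat \<Rightarrow> bool)) \<Rightarrow> (nat \<Rightarrow> bool) \<Rightarrow> (nat \<Rightarrow> bool)"
  where "limit_ext f a n \<longleftrightarrow> (\<exists>m. \<forall>x \<in> ev_const False \<inter> cyl m a. f x n)"

lemma limit_dom_Gdelta:
  "limit_dom f = (\<Inter>n. {a. \<exists>m. \<forall>x \<in> ev_const False \<inter> cyl m a. \<forall>y \<in> ev_const False \<inter> cyl m a. f x n = f y n})"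
  by (auto simp: limit_dom_def)

lemma cyl_open_limit_dom:
  "cyl_open {a. \<exists>m. \<forall>x \<in> ev_const False \<inter> cyl m a. \<forall>y \<in> ev_const False \<inter> cyl m a. f x n = f y n}"
  unfolding cyl_open_def
proof (intro ballI, elim CollectE exE)
  fix a m assume m: "\<forall>x \<in> ev_const False \<inter> cyl m a. \<forall>y \<in> ev_const False \<inter> cyl m a. f x n = f y n"
  have "\<forall>x \<in> ev_const False \<inter> cyl m b. \<forall>y \<in> ev_const False \<inter> cyl m b. f x n = f y n" if "b \<in> cyl m a" for b
    unfolding cyl_eq[OF that] by (rule m)
  then show "\<exists>k. cyl k a \<subseteq> {a. \<exists>m. \<forall>x \<in> ev_const False \<inter> cyl m a. \<forall>y \<in> ev_const False \<inter> cyl m a. f x n = f y n}"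
    by blast
qed

lemma limit_ext_eqI:
  assumes m: "\<And>x. x \<in> ev_const False \<Longrightarrow> x \<in> cyl m a \<Longrightarrow> f x n = v"
  shows "limit_ext f a n = v"
proof -
  have sub: "cyl (max m k) a \<subseteq> cyl m a" "cyl (max m k) a \<subseteq> cyl k a" for k
    by (simp_all add: cyl_antimono)
  show ?thesis
  proof
    assume "limit_ext f a n"
    then obtain k where k: "\<forall>x \<in> ev_const False \<inter> cyl k a. f x n" by (auto simp: limit_ext_def)
    obtain x where "x \<in> ev_const False" "x \<in> cyl (max m k) a" using ev_const_dense[of False "max m k" a] by blast
    then show v using m[of x] k sub[of k] by blast
  next
    assume v
    then show "limit_ext f a n" unfolding limit_ext_def using m by blast
  qed
qed

lemma limit_ext_near:
  assumes "a \<in> limit_dom f"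
  shows "\<exists>m. \<forall>x \<in> ev_const False \<inter> cyl m a. f x n = limit_ext f a n"
proof -
  obtain m where m: "\<forall>x \<in> ev_const False \<inter> cyl m a. \<forall>y \<in> ev_const False \<inter> cyl m a. f x n = f y n"
    using assms unfolding limit_dom_def by blast
  obtain y where "y \<in> ev_const False" "y \<in> cyl m a" using ev_const_dense[of False m a] by blast
  with m have *: "f x n = f y n" if "x \<in> ev_const False" "x \<in> cyl m a" for x
    using that by blast
  have "limit_ext f a n = f y n" by (rule limit_ext_eqI[of m]) (rule *)
  with * show ?thesis by blast
qed

lemma cont_on_limit_ext: "cont_on (limit_dom f) (limit_ext f)"
proof (rule cont_onI)
  fix a i assume "a \<in> limit_dom f"
  then obtain m where m: "\<forall>x \<in> ev_const False \<inter> cyl m a. f x i = limit_ext f a i"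
    using limit_ext_near by blast
  have "limit_ext f b i = limit_ext f a i" if "b \<in> cyl m a" for b
    by (rule limit_ext_eqI[of m]) (use m cyl_eq[OF that] in blast)
  then show "\<exists>m. \<forall>b \<in> limit_dom f \<inter> cyl m a. limit_ext f b i = limit_ext f a i" by blast
qed

lemma limit_ext_continuous:
  assumes "cont_on Y f" "ev_const False \<subseteq> Y" "y \<in> Y"
  shows "y \<in> limit_dom f" "limit_ext f y = f y"
proof -
  have *: "\<exists>m. \<forall>x \<in> ev_const False \<inter> cyl m y. f x n = f y n" for n
  proof -
    obtain m where "f ` (Y \<inter> cyl m y) \<subseteq> cyl (Suc n) (f y)"
      using assms unfolding cont_on_def by blast
    then have "\<forall>x \<in> ev_const False \<inter> cyl m y. f x \<in> cyl (Suc n) (f y)" using assms(2) by blast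
    then have "\<forall>x \<in> ev_const False \<inter> cyl m y. f x n = f y n" by (simp add: cyl_def[of "Suc n"])
    then show ?thesis by blast
  qed
  show "y \<in> limit_dom f"
    unfolding limit_dom_def
  proof (intro CollectI allI)
    fix n
    obtain m where "\<forall>x \<in> ev_const False \<inter> cyl m y. f x n = f y n" using * by blast
    then show "\<exists>m. \<forall>x \<in> ev_const False \<inter> cyl m y. \<forall>z \<in> ev_const False \<inter> cyl m y. f x n = f z n"
      by (intro exI[of _ m]) simp
  qed
  show "limit_ext f y = f y"
  proof
    fix n
    obtain m where "\<forall>x \<in> ev_const False \<inter> cyl m y. f x n = f y n" using * by blast
    then show "limit_ext f y n = f y n" by (intro limit_ext_eqI[of m]) blast
  qed
qed

section \<open>The two kinds of test sets\<close>

text \<open>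
  The second component applies \<open>collapse\<close> to the extension rather than to \<open>f\<close>, so that
  the set depends on countably many values of \<open>f\<close> only.
\<close>

definition tests :: "((nat \<Rightarrow> bool) \<Rightarrow> (nat \<Rightarrow> bool)) \<Rightarrow> ((nat \<Rightarrow> bit) \<times> (nat \<Rightarrow> bit)) set"
  where "tests f = (\<lambda>a. (collapse a, collapse (limit_ext f a))) ` limit_dom f"

lemma tests_cong:
  assumes "\<And>x. x \<in> ev_const False \<Longrightarrow> f x = g x"
  shows "tests f = tests g"
proof -
  have "limit_dom f = limit_dom g" unfolding limit_dom_def using assms by simp
  moreover have "limit_ext f = limit_ext g"
    unfolding limit_ext_def fun_eq_iff using assms by simp
  ultimately show ?thesis by (simp add: tests_def)
qed

lemma range_tests_lepoll: "range tests \<lesssim> (UNIV :: (nat \<Rightarrow> bool) set)"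
proof -
  obtain q :: "(nat \<Rightarrow> bool) \<Rightarrow> nat" where q: "inj_on q (ev_const False)"
    using countable_ev_const_bool unfolding countable_def by blast
  define dec where "dec z x n = z (prod_encode (q x, n))" for z :: "nat \<Rightarrow> bool" and x :: "nat \<Rightarrow> bool" and n
  have "tests f \<in> (\<lambda>z. tests (dec z)) ` UNIV" for f
  proof (rule image_eqI)
    define z where "z k = f (inv_into (ev_const False) q (fst (prod_decode k))) (snd (prod_decode k))" for k
    show "tests f = tests (dec z)"
      by (rule tests_cong) (simp add: dec_def z_def q fun_eq_iff)
  qed simp
  then have "range tests \<subseteq> (\<lambda>z. tests (dec z)) ` UNIV" by blast
  then show ?thesis by (rule subset_image_lepoll)
qed

lemma cyl_avoid_small:
  fixes d :: "nat \<Rightarrow> bit"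
  assumes "V \<prec> (UNIV :: (nat \<Rightarrow> bool) set)"
  shows "\<exists>b \<in> cyl n d. b \<notin> V"
proof (rule ccontr)
  assume "\<not> ?thesis"
  then have sub: "cyl n d \<subseteq> V" by blast
  define e :: "(nat \<Rightarrow> bool) \<Rightarrow> nat \<Rightarrow> bit" where "e s i = (if i < n then d i else of_bool (s (i - n)))" for s i
  have "inj e"
  proof (rule injI)
    fix s t assume "e s = e t"
    then have "e s (n + i) = e t (n + i)" for i by simp
    then have "(of_bool (s i) :: bit) = of_bool (t i)" for i by (simp add: e_def)
    then show "s = t" by (simp only: of_bool_eq_iff fun_eq_iff simp_thms)
  qed
  moreover have "range e \<subseteq> V" using sub by (auto simp: e_def cyl_def)
  ultimately have "(UNIV :: (nat \<Rightarrow> bool) set) \<lesssim> V" unfolding lepoll_def by blast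
  then show False using assms lesspoll_trans1 lesspoll_not_refl by blast
qed

text \<open>
  The second kind of test set makes the coset dense: a pair in \<open>UNIV \<times> cyl n d\<close> puts an
  element of the coset into the cylinder.
\<close>

lemma rich_cyl: "rich (UNIV :: (nat \<Rightarrow> bool) set) (UNIV \<times> cyl n (d::nat \<Rightarrow> bit))"
  unfolding rich_def
proof (intro allI impI)
  fix V :: "(nat \<Rightarrow> bit) set" assume V: "V \<prec> (UNIV :: (nat \<Rightarrow> bool) set)"
  obtain b where b: "b \<in> cyl n d" "b \<notin> V" using cyl_avoid_small[OF V] by blast
  have "V \<union> (\<lambda>v. v + b) ` V \<prec> (UNIV :: (nat \<Rightarrow> bool) set)"
    using V uncountable_infinite[OF uncountable_Cantor] by (intro Un_lesspoll image_lesspoll)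
  from cyl_avoid_small[OF this, of 0] obtain a where a: "a \<notin> V" "a \<notin> (\<lambda>v. v + b) ` V" by auto
  have "a + b \<notin> V"
  proof
    assume "a + b \<in> V"
    then have "(a + b) + b \<in> (\<lambda>v. v + b) ` V" by blast
    then show False using a(2) by (simp add: add.assoc)
  qed
  with a b show "\<exists>(a, b) \<in> UNIV \<times> cyl n d. a \<notin> V \<and> b \<notin> V \<and> a + b \<notin> V"
    by (intro bexI[of _ "(a, b)"]) auto
qed

section \<open>Preimages of cosets of the generic subgroup\<close>

text \<open>
  In characteristic two the condition \<open>c + 1 \<in> H\<close> says that \<open>c\<close> lies in the coset
  \<open>1 + H\<close>. The sequences that are eventually \<open>1\<close> form the coset of \<open>1\<close>
  modulo those that are eventually \<open>0\<close>. That \<open>H\<close> avoids them as well keeps \<open>1 +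
  H\<close> away from the points that \<open>collapse\<close> splits.
\<close>

locale coset_preimage =
  fixes H :: "(nat \<Rightarrow> bit) set"
  assumes add: "\<And>x y. x \<in> H \<Longrightarrow> y \<in> H \<Longrightarrow> x + y \<in> H"
    and avoids: "H \<inter> (ev_const 0 \<union> ev_const 1) = {0}"
    and dense: "\<And>d n. \<exists>c \<in> cyl n d. c + 1 \<in> H"
begin

definition coset where "coset = {c. c + 1 \<in> H}"
definition X where "X = collapse -` coset"

lemma one_ev_const: "(1::nat \<Rightarrow> bit) \<in> ev_const 1"
  unfolding ev_const_def by simp

lemma coset_ev_const: "coset \<inter> ev_const 0 = {}"
proof -
  have False if "c \<in> coset" "c \<in> ev_const 0" for c
  proof -
    have "c + 1 \<in> ev_const (0 + 1)" using that(2) one_ev_const by (rule ev_const_add)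
    then have "c + 1 = 0" using that(1) avoids by (auto simp: coset_def)
    moreover have "c = (c + 1) + 1" by (simp only: add.assoc bit_seq_add_self add_0_right)
    ultimately have "c = 1" by simp
    then show False using that(2) by (auto simp: ev_const_def)
  qed
  then show ?thesis by blast
qed

lemma not_X: "collapse u \<in> ev_const 0 \<Longrightarrow> u \<notin> X"
  using coset_ev_const by (auto simp: X_def)

lemma ev_const_not_X: "ev_const False \<subseteq> - X"
  using not_X collapse_ev_const_iff by blast

lemma coset_add: "c \<in> coset \<Longrightarrow> t \<in> H \<Longrightarrow> c + t \<in> coset"
  using add[of "c + 1" t] by (simp add: coset_def ac_simps)

lemma coset_diff: "c \<in> coset \<Longrightarrow> e \<in> coset \<Longrightarrow> c + e \<in> H"
proof -
  assume "c \<in> coset" "e \<in> coset"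
  then have "(c + 1) + (e + 1) \<in> H" unfolding coset_def by (blast intro: add)
  moreover have "(c + 1) + (e + 1) = (c + e) + (1 + 1)" by (simp only: ac_simps)
  ultimately show ?thesis by (simp only: bit_seq_add_self add_0_right)
qed

text \<open>
  Conjugating translations by elements of \<open>H\<close> with the homeomorphism that \<open>collapse\<close>
  induces from \<open>X\<close> to the coset.
\<close>

lemma homogeneous_X: "homogeneous_space (subtopology Cantor_space X)"
  unfolding homogeneous_space_def
proof (intro ballI)
  let ?K = "subtopology Cantor_space X" and ?B = "subtopology Bit_space coset"
  fix x y assume "x \<in> topspace ?K" "y \<in> topspace ?K"
  then have xy: "x \<in> X" "y \<in> X" by auto
  define t where "t = collapse x + collapse y"
  have t: "t \<in> H" using xy by (auto simp: t_def X_def intro: coset_diff)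
  obtain g where g: "homeomorphic_maps ?K ?B collapse g"
    using homeomorphic_map_collapse[OF coset_ev_const] by (auto simp: homeomorphic_map_maps X_def)
  then have collapse: "homeomorphic_map ?K ?B collapse" and g': "homeomorphic_map ?B ?K g"
    by (auto simp: homeomorphic_maps_map)
  have "cont_on coset (\<lambda>c. c + t)"
    by (intro cont_on_add) (auto simp: cont_on_def intro: exI)
  then have "continuous_map ?B Bit_space (\<lambda>c. c + t)" by (simp only: continuous_map_cyl)
  then have "continuous_map ?B ?B (\<lambda>c. c + t)"
    using coset_add[OF _ t] by (auto simp: continuous_map_in_subtopology)
  then have "homeomorphic_maps ?B ?B (\<lambda>c. c + t) (\<lambda>c. c + t)"
    by (simp add: homeomorphic_maps_def add.assoc)
  then have "homeomorphic_map ?B ?B (\<lambda>c. c + t)" by (auto simp: homeomorphic_map_maps)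
  then have h: "homeomorphic_map ?K ?K (g \<circ> (\<lambda>c. c + t) \<circ> collapse)"
    using collapse g' by (intro homeomorphic_map_compose)
  define h where "h = restrict (g \<circ> (\<lambda>c. c + t) \<circ> collapse) X"
  have "homeomorphic_map ?K ?K h"
    using h by (rule homeomorphic_map_eq) (simp add: h_def)
  then have "h \<in> homeos ?K" by (simp add: homeos_def h_def)
  moreover have "h x = y"
  proof -
    have "collapse x + t = (collapse x + collapse x) + collapse y" by (simp only: t_def add.assoc)
    then have "collapse x + t = collapse y" by simp
    then have "h x = g (collapse y)" using xy by (simp add: h_def)
    then show ?thesis using g xy by (simp add: homeomorphic_maps_def)
  qed
  ultimately show "\<exists>h\<in>homeos ?K. h x = y" by blast
qed

lemma dense_complement: "Cantor_space closure_of (- X) = UNIV"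
proof -
  have "\<exists>y. y \<in> - X \<and> y \<in> W" if W: "x \<in> W" "openin Cantor_space W" for x W
  proof -
    obtain n where "cyl n x \<subseteq> W" using openin_cylD[OF W(2,1)] by blast
    then show ?thesis using ev_const_dense[of False n x] ev_const_not_X by blast
  qed
  then show ?thesis by (auto simp: closure_of_def)
qed

text \<open>
  The heart of the rigidity proof: a homeomorphism of the complement that moves a point satisfies the hypotheses
  of \<open>avoid_small_set\<close> near that point. The argument for a locally constant sum, case
  \<open>3\<close> below, is where the splitting of \<open>ev_const 0\<close> is used.
\<close>

lemma rich_tests:
  assumes f: "homeomorphic_map (subtopology Cantor_space (- X)) (subtopology Cantor_space (- X)) f"
    and y0: "y0 \<notin> X" "f y0 \<noteq> y0"
  shows "rich (UNIV :: (nat \<Rightarrow> bool) set) (tests f)"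
proof -
  define Y where "Y = - X"
  have Y: "ev_const False \<subseteq> Y" using ev_const_not_X by (simp add: Y_def)
  have fY: "f y \<in> Y" if "y \<in> Y" for y
    using f that by (auto simp: Y_def homeomorphic_eq_everything_map continuous_map_def)
  have f_inj: "inj_on f Y" using f by (simp add: Y_def homeomorphic_eq_everything_map)
  have f_cont: "cont_on Y f"
  proof -
    have "continuous_map (subtopology Cantor_space Y) Cantor_space f"
      using f by (auto simp: Y_def homeomorphic_eq_everything_map continuous_map_in_subtopology)
    then show ?thesis by (simp only: continuous_map_cyl)
  qed
  note ext = limit_ext_continuous[OF f_cont Y]
  \<comment> \<open>A cylinder around \<open>y0\<close> that \<open>f\<close> maps off itself.\<close>
  obtain m where m: "\<And>y. y \<in> Y \<Longrightarrow> y \<in> cyl m y0 \<Longrightarrow> f y \<notin> cyl m y0"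
  proof -
    obtain i where i: "f y0 i \<noteq> y0 i" using y0(2) by auto
    obtain k where k: "f ` (Y \<inter> cyl k y0) \<subseteq> cyl (Suc i) (f y0)"
      using f_cont y0(1) unfolding cont_on_def Y_def by blast
    have "f y \<notin> cyl (max k (Suc i)) y0" if "y \<in> Y" "y \<in> cyl (max k (Suc i)) y0" for y
    proof
      assume "f y \<in> cyl (max k (Suc i)) y0"
      then have "f y i = y0 i" by (simp add: cyl_def)
      moreover have "y \<in> cyl k y0" using that(2) cyl_antimono[of k "max k (Suc i)" y0] by auto
      then have "f y \<in> cyl (Suc i) (f y0)" using k that(1) by blast
      then have "f y i = f y0 i" by (simp add: cyl_def)
      ultimately show False using i by simp
    qed
    then show ?thesis by (rule that)
  qed
  \<comment> \<open>Every nonempty open set meets \<open>Y\<close> in points with different images, since it contains all preimages of two points of \<open>ev_const 0\<close>.\<close>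
  have fibre: "\<not> (\<forall>y \<in> Y \<inter> W. collapse y = c)" if W: "openin Cantor_space W" "a \<in> W" for W a c
  proof
    assume *: "\<forall>y \<in> Y \<inter> W. collapse y = c"
    obtain c' n where c': "collapse -` cyl n c' \<subseteq> W" using collapse_irreducible[OF W(2,1)] by blast
    have "d = c" if "d \<in> ev_const 0" "d \<in> cyl n c'" for d
    proof -
      obtain u where u: "collapse u = d" using surj_collapse by (metis surjD)
      then have "u \<in> Y" "u \<in> W" using not_X[of u] that c' by (auto simp: Y_def)
      then show ?thesis using * u by blast
    qed
    then show False using two_ev_const_in_cyl[of n c'] by blast
  qed
  define U where "U k = {a. \<exists>m. \<forall>x \<in> ev_const False \<inter> cyl m a. \<forall>y \<in> ev_const False \<inter> cyl m a. f x k = f y k}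
      \<inter> cyl m y0" for k
  have P: "(\<Inter>k. U k) = limit_dom f \<inter> cyl m y0"
    unfolding U_def limit_dom_Gdelta by blast
  define g where "g a = collapse (limit_ext f a)" for a
  define Gs where "Gs = {collapse, g, \<lambda>a. collapse a + g a}"
  have nonconst: "\<exists>b \<in> (\<Inter>k. U k) \<inter> cyl n a. h b \<noteq> h a"
    if h: "h \<in> Gs" and a: "a \<in> (\<Inter>k. U k)" for h a n
  proof (rule ccontr)
    assume neg: "\<not> ?thesis"
    define W where "W = cyl (max n m) a"
    have W: "openin Cantor_space W" "a \<in> W"
      unfolding W_def openin_cyl by (auto dest: cyl_eq)
    have a_m: "a \<in> cyl m y0" using a by (simp add: P)
    have Wm: "W \<subseteq> cyl m y0" unfolding W_def using cyl_subset[OF a_m, of "max n m"] by simp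
    have Wn: "W \<subseteq> cyl n a" unfolding W_def by (simp add: cyl_antimono)
    have const: "h y = h a" if "y \<in> Y" "y \<in> W" for y
      using neg that ext(1)[OF that(1)] Wm Wn unfolding P by blast
    have g_Y: "g y = collapse (f y)" if "y \<in> Y" for y
      using ext(2)[OF that] by (simp add: g_def)
    consider "h = collapse" | "h = g" | "h = (\<lambda>a. collapse a + g a)"
      using h by (auto simp: Gs_def)
    then show False
    proof cases
      case 1
      then show False using fibre[OF W, of "h a"] const by blast
    next
      case 2
      have "openin (subtopology Cantor_space Y) (f ` (Y \<inter> W))"
        using f W(1) unfolding homeomorphic_eq_everything_map open_map_def Y_def[symmetric]
        by (simp add: openin_subtopology_Int2)
      then obtain S where S: "openin Cantor_space S" "f ` (Y \<inter> W) = S \<inter> Y"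
        by (auto simp: openin_subtopology)
      obtain y where "y \<in> ev_const False" "y \<in> W" using ev_const_dense[of False "max n m" a] by (auto simp: W_def)
      then have "f y \<in> S" using S(2) Y by blast
      moreover have "\<forall>y \<in> Y \<inter> S. collapse y = h a"
      proof
        fix z assume "z \<in> Y \<inter> S"
        then obtain y where "y \<in> Y" "y \<in> W" "z = f y" using S(2) by blast
        then show "collapse z = h a" using const[of y] g_Y[of y] 2 by simp
      qed
      ultimately show False using fibre[OF S(1)] by blast
    next
      case 3
      define x where "x = h a"
      have shift: "collapse (f y) = collapse y + x" if "y \<in> Y" "y \<in> W" for y
      proof -
        have "collapse y + collapse (f y) = x"
          using const[OF that] g_Y[OF that(1)] 3 by (simp add: x_def)
        then have "collapse y + x = (collapse y + collapse y) + collapse (f y)"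
          by (simp only: add.assoc)
        then show ?thesis by simp
      qed
      obtain c k where c: "collapse -` cyl k c \<subseteq> W" using collapse_irreducible[OF W(2,1)] by blast
      obtain d where d: "d \<in> ev_const 0" "d \<in> cyl k c" using ev_const_dense[of 0 k c] by blast
      obtain u w where uw: "u \<noteq> w" "collapse u = d" "collapse w = d"
        using collapse_two_preimages[OF d(1)] by blast
      then have uwY: "u \<in> Y" "w \<in> Y" "u \<in> W" "w \<in> W"
        using not_X[of u] not_X[of w] d c by (auto simp: Y_def)
      show False
      proof (cases "x \<in> H")
        case False
        \<comment> \<open>The coset is dense, and translating one of its points by \<open>x \<notin> H\<close> leads out of it; the preimage of the translate is a point of \<open>Y\<close> that \<open>f\<close> sends into \<open>X\<close>.\<close>
        obtain b where b: "b \<in> cyl k (c + x)" "b \<in> coset" using dense[of k "c + x"] by (auto simp: coset_def)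
        obtain e where e: "collapse e = b + x" using surj_collapse by (metis surjD)
        have "b + x \<in> cyl k c"
        proof -
          have "b i + x i = c i" if "i < k" for i
          proof -
            have "b i = c i + x i" using b(1) that by (simp add: cyl_def)
            then show ?thesis by (cases "c i"; cases "x i") auto
          qed
          then show ?thesis by (simp add: cyl_def)
        qed
        then have "e \<in> W" using c e by auto
        moreover have "e \<in> Y"
        proof -
          have "b + x \<notin> coset"
          proof
            assume "b + x \<in> coset"
            then have "b + (b + x) \<in> H" using b(2) by (intro coset_diff)
            moreover have "b + (b + x) = (b + b) + x" by (simp only: add.assoc)
            ultimately show False using False by simp
          qed
          then show ?thesis using e by (simp add: Y_def X_def)
        qed
        ultimately have "collapse (f e) = (b + x) + x" using shift e by simp
        then have "collapse (f e) = b" by (simp add: add.assoc)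
        then have "f e \<in> X" using b(2) by (simp add: X_def)
        then show False using fY[OF \<open>e \<in> Y\<close>] by (simp add: Y_def)
      next
        case x: True
        show False
        proof (cases "x = 0")
          case True
          \<comment> \<open>The whole fibre over \<open>d\<close> lies in \<open>W\<close>, a set that \<open>f\<close> maps off itself.\<close>
          then have "collapse (f u) = d" using shift uwY uw by simp
          then have "f u \<in> W" using c d by auto
          then show False using m[of u] uwY Wm by blast
        next
          case False
          \<comment> \<open>Above \<open>d\<close> there are two points, above \<open>d + x\<close> only one.\<close>
          have "d + x \<notin> ev_const 0"
          proof
            assume "d + x \<in> ev_const 0"
            then have "d + (d + x) \<in> ev_const (0 + 0)" by (rule ev_const_add[OF d(1)])
            moreover have "d + (d + x) = (d + d) + x" by (simp only: add.assoc)
            ultimately have "x \<in> ev_const 0" by simp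
            then show False using x False avoids by blast
          qed
          then have "f u = f w" using collapse_inj[of "f u" "f w"] shift uwY uw by simp
          then show False using f_inj uwY uw(1) by (auto dest: inj_onD)
        qed
      qed
    qed
  qed
  have U: "cyl_open (U k)" for k
    unfolding U_def by (rule cyl_open_Int_cyl[OF cyl_open_limit_dom])
  have cont_g: "cont_on (\<Inter>k. U k) g"
    unfolding g_def P
    by (rule cont_on_comp[OF cont_on_subset[OF cont_on_limit_ext Int_lower1] cont_on_collapse])
  show ?thesis
    unfolding rich_def
  proof (intro allI impI)
    fix V :: "(nat \<Rightarrow> bit) set" assume V: "V \<prec> (UNIV :: (nat \<Rightarrow> bool) set)"
    have "\<exists>a \<in> (\<Inter>k. U k). \<forall>h \<in> Gs. h a \<notin> V"
    proof (rule avoid_small_set[OF _ U _ _ nonconst V])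
      show "(\<Inter>k. U k) \<noteq> {}"
        unfolding P using ext(1)[of y0] y0(1) by (auto simp: Y_def)
      show "cont_on (\<Inter>k. U k) h" if "h \<in> Gs" for h
      proof -
        have "cont_on (\<Inter>k. U k) (\<lambda>a. collapse a + g a)"
          by (intro cont_on_add cont_on_collapse cont_g)
        then show ?thesis using that cont_g cont_on_collapse unfolding Gs_def by blast
      qed
    qed (auto simp: Gs_def)
    then obtain a where a: "a \<in> limit_dom f" "\<forall>h \<in> Gs. h a \<notin> V" unfolding P by blast
    then show "\<exists>(a, b) \<in> tests f. a \<notin> V \<and> b \<notin> V \<and> a + b \<notin> V"
      unfolding tests_def by (intro bexI[of _ "(collapse a, collapse (limit_ext f a))"]) (auto simp: Gs_def g_def)
  qed
qed

end

theorem theorem6: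
  shows "\<exists>X \<subseteq> topspace Cantor_space.
    homogeneous_space (subtopology Cantor_space X) \<and>
    Cantor_space closure_of (topspace Cantor_space - X) = topspace Cantor_space \<and>
    rigid_space (subtopology Cantor_space (topspace Cantor_space - X))"
proof -
  let ?\<kappa> = "UNIV :: (nat \<Rightarrow> bool) set"
  define \<C> :: "((nat \<Rightarrow> bit) \<times> (nat \<Rightarrow> bit)) set set"
    where "\<C> = (\<lambda>(n, d). UNIV \<times> cyl n d) ` (UNIV \<times> ev_const 0)"
  define \<T> where "\<T> = {T \<in> range tests. rich ?\<kappa> T} \<union> \<C>"
  have "countable \<C>"
    unfolding \<C>_def by (intro countable_image countable_SIGMA countable_ev_const_bit) auto
  then have "\<C> \<prec> ?\<kappa>" by (rule countable_lesspoll_uncountable[OF _ uncountable_Cantor])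
  then have "\<C> \<lesssim> ?\<kappa>" by (rule lesspoll_imp_lepoll)
  moreover have "{T \<in> range tests. rich ?\<kappa> T} \<lesssim> ?\<kappa>"
    by (rule lepoll_trans[OF subset_imp_lepoll range_tests_lepoll]) blast
  ultimately have \<T>: "\<T> \<lesssim> ?\<kappa>"
    unfolding \<T>_def using uncountable_infinite[OF uncountable_Cantor] by (intro Un_lepoll)
  have rich: "rich ?\<kappa> T" if "T \<in> \<T>" for T
    using that rich_cyl by (auto simp: \<T>_def \<C>_def)
  have G: "countable (ev_const 0 \<union> ev_const (1::bit))" by (simp add: countable_ev_const_bit)
  have G0: "0 \<in> ev_const 0 \<union> ev_const (1::bit)" and G1: "1 \<in> ev_const 0 \<union> ev_const (1::bit)"
    by (simp_all add: ev_const_def)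
  obtain H :: "(nat \<Rightarrow> bit) set" where
    H: "0 \<in> H" "\<And>x y. x \<in> H \<Longrightarrow> y \<in> H \<Longrightarrow> x + y \<in> H" "H \<inter> (ev_const 0 \<union> ev_const 1) = {0}"
    and hit: "\<And>T. T \<in> \<T> \<Longrightarrow> \<exists>(a, b) \<in> T. b + 1 \<in> H \<and> (\<forall>g \<in> ev_const 0 \<union> ev_const 1. a + g \<notin> H)"
    using generic_subgroup[OF bit_seq_add_self uncountable_Cantor G G0 G1 \<T> rich] by blast
  \<comment> \<open>Every cylinder has a centre in \<open>ev_const 0\<close>, so the coset was made to meet it.\<close>
  have dense: "\<exists>c \<in> cyl n d. c + 1 \<in> H" for n d
  proof -
    obtain e where e: "e \<in> ev_const 0" "e \<in> cyl n d" using ev_const_dense[of 0 n d] by blast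
    then have "UNIV \<times> cyl n e \<in> \<T>" unfolding \<T>_def \<C>_def by blast
    from hit[OF this] show ?thesis using cyl_eq[OF e(2)] by auto
  qed
  interpret coset_preimage H
    by unfold_locales (use H dense in auto)
  have fixed: "f y = y"
    if f: "homeomorphic_map (subtopology Cantor_space (- X)) (subtopology Cantor_space (- X)) f"
      and y: "y \<in> - X" for f y
  proof (rule ccontr)
    assume "f y \<noteq> y"
    then have "rich ?\<kappa> (tests f)" using rich_tests[OF f] y by blast
    then have "tests f \<in> \<T>" by (simp add: \<T>_def)
    from hit[OF this] obtain a where a: "a \<in> limit_dom f" "collapse (limit_ext f a) + 1 \<in> H"
      "\<forall>g \<in> ev_const 0 \<union> ev_const 1. collapse a + g \<notin> H"
      by (auto simp: tests_def)
    have "a \<in> - X" using a(3) G1 by (auto simp: X_def coset_def)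
    moreover have cont: "cont_on (- X) f"
    proof -
      have "continuous_map (subtopology Cantor_space (- X)) Cantor_space f"
        using f by (auto simp: homeomorphic_eq_everything_map continuous_map_in_subtopology)
      then show ?thesis by (simp only: continuous_map_cyl)
    qed
    ultimately have "f a \<in> X"
      using a(2) limit_ext_continuous(2)[OF cont ev_const_not_X] by (simp add: X_def coset_def)
    moreover have "f a \<in> - X"
      using f \<open>a \<in> - X\<close> by (auto simp: homeomorphic_eq_everything_map continuous_map_def)
    ultimately show False by simp
  qed
  have "rigid_space (subtopology Cantor_space (- X))"
  proof -
    let ?Y = "subtopology Cantor_space (- X)"
    have only: "h = (\<lambda>x \<in> - X. x)" if "h \<in> homeos ?Y" for h
    proof
      fix x
      have "h \<in> extensional (- X)" "homeomorphic_map ?Y ?Y h" using that by (simp_all add: homeos_def)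
      then show "h x = (\<lambda>x \<in> - X. x) x"
        using fixed[of h x] by (cases "x \<in> X") (simp_all add: extensional_def)
    qed
    have mem: "(\<lambda>x \<in> - X. x) \<in> homeos ?Y"
    proof -
      have "homeomorphic_map ?Y ?Y id" by simp
      then have "homeomorphic_map ?Y ?Y (\<lambda>x \<in> - X. x)" by (rule homeomorphic_map_eq) simp
      then show ?thesis by (simp add: homeos_def)
    qed
    have "homeos ?Y = {\<lambda>x \<in> - X. x}"
    proof (intro equalityI subsetI)
      fix h assume "h \<in> homeos ?Y"
      from only[OF this] show "h \<in> {\<lambda>x \<in> - X. x}" unfolding singleton_iff .
    next
      fix h assume "h \<in> {\<lambda>x \<in> - X. x}"
      then have eq: "h = (\<lambda>x \<in> - X. x)" unfolding singleton_iff .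
      show "h \<in> homeos ?Y" unfolding eq by (rule mem)
    qed
    then show ?thesis by (simp add: rigid_space_def)
  qed
  then show ?thesis
    using homogeneous_X dense_complement
    by (intro exI[of _ X]) (simp add: Compl_eq_Diff_UNIV)
qed

end
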